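(* Let $k\ge 2$ be an integer and let $E\subset\mathbb{R}^2$ be a finite point set with $|E|>k+1$. Then $$|M_2(k)(E)|\gtrapprox |E|^k,$$ i.e. for every $\epsilon>0$ there is a constant $C_\epsilon>0$ (independent of $E$) such that $|E|^k\le C_\epsilon |E|^{\epsilon}\,|M_2(k)(E)|$. Moreover, this lower bound is in general best possible: there exist finite sets $E\subset\mathbb{R}^2$ of arbitrarily large size with $|M_2(k)(E)|\lesssim |E|^k$.
   Context: A $(k+1)$-tuple $(x^1,\dots,x^{k+1})$ of points of $\mathbb{R}^2$ is called non-singular if its first $3$ points $x^1,x^2,x^3$ are affinely independent. Two non-singular $(k+1)$-tuples $(x^1,\dots,x^{k+1})$ and $(y^1,\dots,y^{k+1})$ are congruent if there exist a rotation $\theta$ and a translation $\tau$ of the plane with $y^j=\theta x^j+\tau$ for all $1\le j\le k+1$. $M_2(k)(E)$ denotes the set of congruence classes of non-singular $(k+1)$-tuples all of whose points lie in $E$. The notation $X\lessapprox Y$ (with controlling parameter $|E|$) means: for every $\epsilon>0$ there is $C_\epsilon>0$ with $X\le C_\epsilon|E|^\epsilon Y$; $X\lesssim Y$ means $X\le CY$ for a constant $C$ independent of $E$.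
   Formalization: The lower bound is stated for E not contained in a line: for collinear E there are no non-singular tuples, so M_2(k)(E) is empty and the bound fails. The extremal sets in the sharpness part are also shown to be non-collinear, which is stronger. *)

theory Defs
  imports "HOL-Analysis.Analysis"
begin

text \<open>
  An n-tuple of points of S is an extensional function on {1..n}, so that two tuples are equal
  iff their n entries agree.
\<close>

definition tuples :: "nat \<Rightarrow> 'a set \<Rightarrow> (nat \<Rightarrow> 'a) set"
  where "tuples n S = {1..n} \<rightarrow>\<^sub>E S"

text \<open>
  \<^const>\<open>affine_dependent\<close> is a property of the underlying set and does not see repetitions;
  affine independence of the triple (x 1, x 2, x 3) therefore also requires that its entries are
  pairwise distinct.
\<close>

definition nonsingular :: "(nat \<Rightarrow> real^2) \<Rightarrow> bool"
  where "nonsingular x \<longleftrightarrow> inj_on x {1,2,3} \<and> \<not> affine_dependent (x ` {1,2,3})"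

definition nonsingular_tuples :: "nat \<Rightarrow> (real^2) set \<Rightarrow> (nat \<Rightarrow> real^2) set"
  where "nonsingular_tuples k E = {x \<in> tuples (k+1) E. nonsingular x}"

text \<open>
  Only orientation-preserving rigid motions are allowed: \<^const>\<open>rotation_matrix\<close> means
  orthogonal with determinant 1.
\<close>

definition congruence :: "nat \<Rightarrow> ((nat \<Rightarrow> real^2) \<times> (nat \<Rightarrow> real^2)) set"
  where "congruence k =
    {(x, y). x \<in> nonsingular_tuples k UNIV \<and> y \<in> nonsingular_tuples k UNIV \<and>
      (\<exists>(\<theta>::real^2^2) (\<tau>::real^2). rotation_matrix \<theta> \<and> (\<forall>j\<in>{1..k+1}. y j = \<theta> *v x j + \<tau>))}"

text \<open>
  A class is a class of tuples of the whole plane; those counted are the ones with a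
  representative all of whose points lie in E.
\<close>

definition M2 :: "nat \<Rightarrow> (real^2) set \<Rightarrow> (nat \<Rightarrow> real^2) set set"
  where "M2 k E = nonsingular_tuples k E // congruence k"

lemma equiv_congruence: "equiv (nonsingular_tuples k UNIV) (congruence k)"
proof (rule equivI)
  show "congruence k \<subseteq> nonsingular_tuples k UNIV \<times> nonsingular_tuples k UNIV"
    by (auto simp: congruence_def)
  have "rotation_matrix (mat 1 :: real^2^2)"
    by (simp add: rotation_matrix_def orthogonal_matrix_id)
  then have "\<exists>\<theta> \<tau>. rotation_matrix \<theta> \<and> (\<forall>j\<in>{1..k+1}. x j = \<theta> *v x j + \<tau>)" for x :: "nat \<Rightarrow> real^2"
    by (intro exI[of _ "mat 1"] exI[of _ 0]) simp
  then show "refl_on (nonsingular_tuples k UNIV) (congruence k)"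
    by (auto simp: refl_on_def congruence_def)
  show "sym (congruence k)"
  proof (rule symI)
    fix x y assume "(x, y) \<in> congruence k"
    then obtain \<theta> \<tau> where *: "x \<in> nonsingular_tuples k UNIV" "y \<in> nonsingular_tuples k UNIV"
      "rotation_matrix \<theta>" "\<And>j. j \<in> {1..k+1} \<Longrightarrow> y j = \<theta> *v x j + \<tau>"
      by (auto simp: congruence_def)
    have "rotation_matrix (transpose \<theta>)"
      using *(3) by (simp add: rotation_matrix_def orthogonal_matrix_transpose)
    moreover have "x j = transpose \<theta> *v y j + - (transpose \<theta> *v \<tau>)" if "j \<in> {1..k+1}" for j
    proof -
      have "transpose \<theta> ** \<theta> = mat 1"
        using *(3) by (simp add: rotation_matrix_def orthogonal_matrix_def)
      then show ?thesis
        using *(4)[OF that] by (simp add: matrix_vector_right_distrib matrix_vector_mul_assoc del: transpose_matrix_vector)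
    qed
    ultimately show "(y, x) \<in> congruence k"
      using *(1,2) unfolding congruence_def by blast
  qed
  show "trans (congruence k)"
  proof (rule transI)
    fix x y z assume "(x, y) \<in> congruence k" "(y, z) \<in> congruence k"
    then obtain \<theta> \<tau> \<theta>' \<tau>' where *: "x \<in> nonsingular_tuples k UNIV" "z \<in> nonsingular_tuples k UNIV"
      "rotation_matrix \<theta>" "\<And>j. j \<in> {1..k+1} \<Longrightarrow> y j = \<theta> *v x j + \<tau>"
      "rotation_matrix \<theta>'" "\<And>j. j \<in> {1..k+1} \<Longrightarrow> z j = \<theta>' *v y j + \<tau>'"
      by (auto simp: congruence_def)
    have "rotation_matrix (\<theta>' ** \<theta>)"
      using *(3,5) by (simp add: rotation_matrix_def orthogonal_matrix_mul det_mul)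
    moreover have "z j = (\<theta>' ** \<theta>) *v x j + (\<theta>' *v \<tau> + \<tau>')" if "j \<in> {1..k+1}" for j
      using *(4)[OF that] *(6)[OF that]
      by (simp add: matrix_vector_right_distrib matrix_vector_mul_assoc)
    ultimately show "(x, z) \<in> congruence k"
      using *(1,2) unfolding congruence_def by blast
  qed
qed

text \<open>A set contained in a line has no non-singular tuples, so the count is 0 for it.\<close>

lemma M2_collinear_empty:
  assumes "k \<ge> 2" "collinear E"
  shows "M2 k E = {}"
proof -
  have False if x: "x \<in> nonsingular_tuples k E" for x
  proof -
    have sub: "x ` {1,2,3} \<subseteq> E"
      using x \<open>k \<ge> 2\<close> by (auto simp: nonsingular_tuples_def tuples_def PiE_def Pi_def)
    have inj: "inj_on x {1,2,3}" and ind: "\<not> affine_dependent (x ` {1,2,3})"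
      using x by (auto simp: nonsingular_tuples_def nonsingular_def)
    have "collinear (x ` {1,2,3})"
      using sub assms(2) collinear_subset by blast
    moreover have "card (x ` {1,2,3}) = 3"
      using card_image[OF inj] by simp
    ultimately show False
      using ind collinear_3_eq_affine_dependent[of "x 1" "x 2" "x 3"] inj
      by (auto simp: inj_on_def)
  qed
  then show ?thesis
    by (auto simp: M2_def quotient_def)
qed

end

(*
  Cauchy-Schwarz reduces the lower bound to counting congruent pairs of tuples: if a rigid motion g
  maps r(g) points of E into E, there are at most sum_g r(g)^(k+1) such pairs. The non-translations
  are parametrised by R^3 so that the motions taking a to b form a line; a generic projection to
  the plane keeps motions and lines distinct, so motions with r(g) >= t become t-rich points of
  |E|^2 lines and Szemeredi-Trotter gives O(|E|^4 / t^3) of them. Summing over t yields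
  |E|^(k+2) times a harmonic sum. This needs |E|^(k+1) / 4 non-singular tuples; otherwise some line
  contains half of E, and tuples of points of that line preceded by one point off the line are
  pairwise incongruent. Szemeredi-Trotter follows from the crossing lemma, whose linear bound for
  plane drawings is obtained by charging each pair of consecutive edges leaving a vertex to the
  first vertex reached in the wedge between them. The bound is attained by a line of equally spaced
  points plus one more point, as its difference set has linear size.
*)

theory Submission
  imports Defs
begin

section \<open>Plane drawings with straight edges\<close>

text \<open>Plane motions form a three-parameter family, so incidence bounds for points and lines do
  not apply directly. The coordinates are chosen so that "a goes to b" becomes a line that is a
  graph over the first coordinate; a projection keeping this coordinate produces no vertical lines,
  and every edge can be the graph of an affine function over an interval. The price is that the
  rotation factor 1 is missed: translations are counted separately and contribute only
  \<open>|E|^(k+2)\<close> pairs. The exponent 3 is critical: the bound for \<open>t\<close>-rich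
  motions decays like \<open>t^-3\<close>, and a third moment weighs it by \<open>t^2\<close>, which
  leaves \<open>1/t\<close>. The harmonic sum is thus the only source of the
  \<open>|E|^\<epsilon>\<close> loss, and for k > 2 the surplus factors \<open>r(g)^(k-2)\<close>
  are bounded trivially by \<open>|E|^(k-2)\<close>.\<close>

datatype seg = Seg (slope: real) (icpt: real) (lft: real) (rgt: real)

definition height :: "seg \<Rightarrow> real \<Rightarrow> real"
  where "height e x = slope e * x + icpt e"

definition left_end :: "seg \<Rightarrow> real \<times> real"
  where "left_end e = (lft e, height e (lft e))"

definition right_end :: "seg \<Rightarrow> real \<times> real"
  where "right_end e = (rgt e, height e (rgt e))"

text \<open>Common end points do not count, but an overlap of two segments of one line does.\<close>

definition crosses :: "seg \<Rightarrow> seg \<Rightarrow> bool"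
  where "crosses e f \<longleftrightarrow> (\<exists>x. lft e < x \<and> x < rgt e \<and> lft f < x \<and> x < rgt f \<and> height e x = height f x)"

text \<open>A sign change would force a zero by the intermediate value theorem. Only a weak
  inequality survives at \<open>l\<close> and \<open>r\<close>, where two edges may share a
  vertex.\<close>

lemma linear_sign:
  fixes p q :: real
  assumes nz: "\<And>x. l < x \<Longrightarrow> x < r \<Longrightarrow> p * x + q \<noteq> 0"
    and x0: "l < x0" "x0 < r" "p * x0 + q > 0"
    and x: "l \<le> x" "x \<le> r"
  shows "p * x + q \<ge> 0"
proof (rule ccontr)
  assume neg: "\<not> p * x + q \<ge> 0"
  have cont: "continuous_on S (\<lambda>x. p * x + q)" for S
    by (intro continuous_intros)
  show False
  proof (cases "x0 \<le> x")
    case True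
    obtain z where "x0 \<le> z" "z \<le> x" "p * z + q = 0"
      using IVT2'[of "\<lambda>x. p * x + q" x 0 x0] cont neg x0 True by auto
    then show False
      using nz[of z] neg x0 x by (cases "z = x") auto
  next
    case False
    obtain z where "x \<le> z" "z \<le> x0" "p * z + q = 0"
      using IVT'[of "\<lambda>x. p * x + q" x 0 x0] cont neg x0 False by auto
    then show False
      using nz[of z] neg x0 x by (cases "z = x") auto
  qed
qed

locale segment_system =
  fixes V :: "(real \<times> real) set" and F :: "seg set"
  assumes finV: "finite V" and finF: "finite F"
    and lft_less: "e \<in> F \<Longrightarrow> lft e < rgt e"
    and left_in: "e \<in> F \<Longrightarrow> left_end e \<in> V"
    and right_in: "e \<in> F \<Longrightarrow> right_end e \<in> V"
    and interior: "e \<in> F \<Longrightarrow> v \<in> V \<Longrightarrow> lft e < fst v \<Longrightarrow> fst v < rgt e \<Longrightarrow> height e (fst v) \<noteq> snd v"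

locale plane_drawing = segment_system +
  assumes noncrossing: "e \<in> F \<Longrightarrow> f \<in> F \<Longrightarrow> e \<noteq> f \<Longrightarrow> \<not> crosses e f"
begin

lemma height_le:
  assumes "e \<in> F" "f \<in> F" "e \<noteq> f"
    and "lft e \<le> l" "lft f \<le> l" "r \<le> rgt e" "r \<le> rgt f"
    and "l < x0" "x0 < r" "height e x0 < height f x0" "l \<le> x" "x \<le> r"
  shows "height e x \<le> height f x"
proof -
  have "(slope f - slope e) * x + (icpt f - icpt e) \<ge> 0"
  proof (rule linear_sign[of l r])
    fix z assume z: "l < z" "z < r"
    then have "height e z \<noteq> height f z"
      using noncrossing[OF assms(1,2,3)] assms unfolding crosses_def by force
    then show "(slope f - slope e) * z + (icpt f - icpt e) \<noteq> 0"
      by (auto simp: height_def algebra_simps)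
  qed (use assms in \<open>auto simp: height_def algebra_simps\<close>)
  then show ?thesis
    by (auto simp: height_def algebra_simps)
qed

lemma height_neq:
  assumes "e \<in> F" "f \<in> F" "e \<noteq> f" "lft e < x" "lft f < x" "x < rgt e" "x < rgt f"
  shows "height e x \<noteq> height f x"
  using noncrossing[OF assms(1,2,3)] assms unfolding crosses_def by force

text \<open>Edges leaving one vertex with equal slope would overlap, which counts as a crossing.
  Hence slopes order the edges at a vertex strictly.\<close>

lemma same_start:
  assumes "e \<in> F" "f \<in> F" "left_end e = left_end f" "slope e = slope f"
  shows "e = f"
proof (rule ccontr)
  assume "e \<noteq> f"
  have l: "lft e = lft f" and "icpt e = icpt f"
    using assms by (auto simp: left_end_def height_def)
  then have "height e x = height f x" for x
    using assms by (simp add: height_def)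
  moreover obtain x where "lft e < x" "x < min (rgt e) (rgt f)"
    using dense[of "lft e" "min (rgt e) (rgt f)"] lft_less[OF assms(1)] lft_less[OF assms(2)] l by auto
  ultimately show False
    using height_neq[OF assms(1,2) \<open>e \<noteq> f\<close>, of x] l by auto
qed

section \<open>Wedges between consecutive edges, and the linear edge bound\<close>

definition next_above :: "seg \<Rightarrow> seg \<Rightarrow> bool"
  where "next_above e e' \<longleftrightarrow> e \<in> F \<and> e' \<in> F \<and> left_end e = left_end e' \<and> slope e < slope e' \<and>
    (\<forall>f\<in>F. left_end f = left_end e \<longrightarrow> \<not> (slope e < slope f \<and> slope f < slope e'))"

lemma next_above_unique:
  assumes "next_above e f" "next_above e g"
  shows "f = g"
proof -
  have "slope f = slope g"
    using assms unfolding next_above_def by (metis linorder_less_linear)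
  then show ?thesis
    using assms same_start[of f g] unfolding next_above_def by auto
qed

text \<open>Followed to the left, \<open>f\<close> is trapped between \<open>e\<close> and
  \<open>e'\<close>. It must then start at an earlier vertex of the wedge, pass through the apex in
  its interior, or leave the apex with a slope in between; each is excluded.\<close>

lemma wedge_no_edge:
  assumes na: "next_above e e'"
    and xw: "lft e < xw" "xw \<le> rgt e" "xw \<le> rgt e'"
    and first: "\<And>u. u \<in> V \<Longrightarrow> lft e < fst u \<Longrightarrow> fst u < xw \<Longrightarrow>
      height e (fst u) \<le> snd u \<Longrightarrow> snd u \<le> height e' (fst u) \<Longrightarrow> False"
    and f: "f \<in> F" "f \<noteq> e" "f \<noteq> e'" "lft f < xw" "xw \<le> rgt f"
    and x0: "lft f < x0" "lft e < x0" "x0 < xw" "height e x0 < height f x0" "height f x0 < height e' x0"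
  shows False
proof -
  define l where "l = max (lft f) (lft e)"
  have F: "e \<in> F" "e' \<in> F" and le: "lft e' = lft e" and same: "height e (lft e) = height e' (lft e)"
    using na by (auto simp: next_above_def left_end_def)
  have lo: "height e x \<le> height f x" if "l \<le> x" "x \<le> xw" for x
    using height_le[of e f l xw x0 x] that F f xw x0 unfolding l_def by auto
  have hi: "height f x \<le> height e' x" if "l \<le> x" "x \<le> xw" for x
    using height_le[of f e' l xw x0 x] that F f xw x0 le unfolding l_def by auto
  consider "lft f > lft e" | "lft f < lft e" | "lft f = lft e" by linarith
  then show False
  proof cases
    case 1
    then show False
      using first[OF left_in[OF f(1)]] f lo[of "lft f"] hi[of "lft f"]
      by (auto simp: left_end_def l_def)
  next
    case 2
    then have "height f (lft e) = height e (lft e)"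
      using lo[of "lft e"] hi[of "lft e"] same xw unfolding l_def by auto
    then show False
      using interior[OF f(1) left_in[OF F(1)]] 2 f xw by (auto simp: left_end_def)
  next
    case 3
    then have eq: "height f (lft e) = height e (lft e)"
      using lo[of "lft e"] hi[of "lft e"] same xw unfolding l_def by auto
    then have "left_end f = left_end e"
      using 3 by (auto simp: left_end_def)
    moreover have "slope e * (x0 - lft e) < slope f * (x0 - lft e)"
      "slope f * (x0 - lft e) < slope e' * (x0 - lft e)"
      using eq x0 same by (auto simp: height_def algebra_simps)
    then have "slope e < slope f" "slope f < slope e'"
      using x0 by (auto simp: mult_less_cancel_right)
    ultimately show False
      using na f unfolding next_above_def by auto
  qed
qed

text \<open>The comparison is made to the left of \<open>w\<close>, not at \<open>fst w\<close>
  itself: several edges may end at one point below \<open>w\<close>, and their order further left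
  breaks the tie.\<close>

definition nearest_below :: "real \<times> real \<Rightarrow> seg \<Rightarrow> bool"
  where "nearest_below w e \<longleftrightarrow> e \<in> F \<and> lft e < fst w \<and> fst w \<le> rgt e \<and> height e (fst w) < snd w \<and>
    (\<forall>f\<in>F. f \<noteq> e \<and> lft f < fst w \<and> fst w \<le> rgt f \<and> height f (fst w) < snd w \<longrightarrow>
      (\<forall>x. lft e < x \<and> lft f < x \<and> x < fst w \<longrightarrow> height f x < height e x))"

definition nearest_above :: "real \<times> real \<Rightarrow> seg \<Rightarrow> bool"
  where "nearest_above w e \<longleftrightarrow> e \<in> F \<and> lft e < fst w \<and> fst w \<le> rgt e \<and> snd w < height e (fst w) \<and>
    (\<forall>f\<in>F. f \<noteq> e \<and> lft f < fst w \<and> fst w \<le> rgt f \<and> snd w < height f (fst w) \<longrightarrow>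
      (\<forall>x. lft e < x \<and> lft f < x \<and> x < fst w \<longrightarrow> height e x < height f x))"

lemma nearest_below_unique:
  assumes "nearest_below w e" "nearest_below w f"
  shows "e = f"
proof (rule ccontr)
  assume ne: "e \<noteq> f"
  obtain x where x: "max (lft e) (lft f) < x" "x < fst w"
    using dense[of "max (lft e) (lft f)" "fst w"] assms by (auto simp: nearest_below_def)
  then have "height f x < height e x" "height e x < height f x"
    using assms ne unfolding nearest_below_def by auto
  then show False by simp
qed

lemma nearest_above_unique:
  assumes "nearest_above w e" "nearest_above w f"
  shows "e = f"
proof (rule ccontr)
  assume ne: "e \<noteq> f"
  obtain x where x: "max (lft e) (lft f) < x" "x < fst w"
    using dense[of "max (lft e) (lft f)" "fst w"] assms by (auto simp: nearest_above_def)
  then have "height f x < height e x" "height e x < height f x"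
    using assms ne unfolding nearest_above_def by auto
  then show False by simp
qed

text \<open>Take a leftmost vertex \<open>w\<close> of the closed wedge. If \<open>w\<close> is off
  \<open>e\<close>, then \<open>e\<close> is the edge just below it; if \<open>w\<close> is on
  \<open>e\<close>, it lies strictly below \<open>e'\<close>, which is then the edge just above
  it.\<close>

lemma wedge_closes:
  assumes na: "next_above e e'"
  shows "\<exists>w\<in>V. nearest_below w e \<or> nearest_above w e'"
proof -
  have F: "e \<in> F" "e' \<in> F" and le: "lft e' = lft e" and same: "height e (lft e) = height e' (lft e)"
    and sl: "slope e < slope e'" and ne: "e \<noteq> e'"
    using na by (auto simp: next_above_def left_end_def)
  have less: "height e x < height e' x" if "lft e < x" for x
  proof -
    have "slope e * (x - lft e) < slope e' * (x - lft e)"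
      using that sl by simp
    then show ?thesis using same by (simp add: height_def algebra_simps)
  qed
  \<comment> \<open>The wedge is cut off where the first of its two edges ends. That end is a vertex
    of the wedge, so \<open>U\<close> is not empty.\<close>
  define U where "U = {u \<in> V. lft e < fst u \<and> fst u \<le> rgt e \<and> fst u \<le> rgt e' \<and>
    height e (fst u) \<le> snd u \<and> snd u \<le> height e' (fst u)}"
  have finU: "finite U" unfolding U_def using finV by simp
  have "U \<noteq> {}"
  proof (cases "rgt e \<le> rgt e'")
    case True
    then have "right_end e \<in> U"
      using right_in[OF F(1)] lft_less[OF F(1)] less[of "rgt e"] by (auto simp: U_def right_end_def)
    then show ?thesis by auto
  next
    case False
    then have "right_end e' \<in> U"
      using right_in[OF F(2)] lft_less[OF F(2)] less[of "rgt e'"] le by (auto simp: U_def right_end_def)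
    then show ?thesis by auto
  qed
  then obtain w where w: "w \<in> U" "\<And>u. u \<in> U \<Longrightarrow> fst w \<le> fst u"
    using arg_min_if_finite[OF finU, of fst] by (metis not_le)
  note wU = w(1)[unfolded U_def, simplified]
  have first: False if "u \<in> V" "lft e < fst u" "fst u < fst w"
      "height e (fst u) \<le> snd u" "snd u \<le> height e' (fst u)" for u
  proof -
    have "u \<in> U" using that wU unfolding U_def by auto
    then show False using w(2) that by fastforce
  qed
  have noedge: False if "f \<in> F" "f \<noteq> e" "f \<noteq> e'" "lft f < fst w" "fst w \<le> rgt f"
      "lft f < x" "lft e < x" "x < fst w" "height e x < height f x" "height f x < height e' x" for f x
    using wedge_no_edge[OF na, of "fst w" f x] that first wU by blast
  show ?thesis
  proof (cases "height e (fst w) = snd w")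
    case False
    have "nearest_below w e"
      unfolding nearest_below_def
    proof (intro conjI ballI allI impI)
      fix f x assume f: "f \<in> F" "f \<noteq> e \<and> lft f < fst w \<and> fst w \<le> rgt f \<and> height f (fst w) < snd w"
        and x: "lft e < x \<and> lft f < x \<and> x < fst w"
      have fe': "f \<noteq> e'" using f wU by auto
      \<comment> \<open>Were \<open>f\<close> above \<open>e\<close> at \<open>x\<close>, it could
        not be inside the wedge, so it would be above \<open>e'\<close> and remain there up to
        \<open>w\<close>, although it passes below \<open>w\<close>.\<close>
      show "height f x < height e x"
      proof (rule ccontr)
        assume "\<not> ?thesis"
        then have a: "height e x < height f x"
          using height_neq[of f e x] f x F wU by auto
        then have "\<not> height f x < height e' x"
          using noedge f fe' x by blast
        then have "height e' x < height f x"
          using height_neq[of f e' x] f x F wU fe' le by auto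
        then have "height e' (fst w) \<le> height f (fst w)"
          using height_le[of e' f "max (lft e) (lft f)" "fst w" x "fst w"] f fe' x F wU le by auto
        then show False using f wU by auto
      qed
    qed (use F wU False in auto)
    then show ?thesis using wU by auto
  next
    case True
    have "nearest_above w e'"
      unfolding nearest_above_def
    proof (intro conjI ballI allI impI)
      fix f x assume f: "f \<in> F" "f \<noteq> e' \<and> lft f < fst w \<and> fst w \<le> rgt f \<and> snd w < height f (fst w)"
        and x: "lft e' < x \<and> lft f < x \<and> x < fst w"
      have fe: "f \<noteq> e" using f True by auto
      show "height e' x < height f x"
      proof (rule ccontr)
        assume "\<not> ?thesis"
        then have a: "height f x < height e' x"
          using height_neq[of f e' x] f x F wU by auto
        then have "\<not> height e x < height f x"
          using noedge f fe x le by auto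
        then have "height f x < height e x"
          using height_neq[of f e x] f x F wU fe le by auto
        then have "height f (fst w) \<le> height e (fst w)"
          using height_le[of f e "max (lft e) (lft f)" "fst w" x "fst w"] f fe x F wU le by auto
        then show False using f True by auto
      qed
    qed (use F wU True le less[of "fst w"] in auto)
    then show ?thesis using wU by auto
  qed
qed

text \<open>The lowest edges at the left ends number at most \<open>card V\<close>. Every other edge
  has a predecessor and is charged to a vertex with a flag telling which alternative of
  \<open>wedge_closes\<close> holds; uniqueness of the nearest edges bounds these by
  \<open>2 * card V\<close>.\<close>

lemma card_edges_le: "card F \<le> 3 * card V"
proof -
  define F' where "F' = {e' \<in> F. \<exists>e. next_above e e'}"
  have ex_next: "\<exists>g. next_above g e'" if "e \<in> F" "e' \<in> F" "left_end e = left_end e'" "slope e < slope e'" for e e'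
  proof -
    define G where "G = {f \<in> F. left_end f = left_end e' \<and> slope f < slope e'}"
    have "finite G" "e \<in> G" using finF that by (auto simp: G_def)
    then obtain g where g: "g \<in> G" "\<And>f. f \<in> G \<Longrightarrow> \<not> slope g < slope f"
      using arg_min_if_finite[of G "\<lambda>f. - slope f"] by (metis empty_iff neg_less_iff_less)
    then have "next_above g e'"
      using that unfolding next_above_def G_def by auto
    then show ?thesis ..
  qed
  have "inj_on left_end (F - F')"
  proof (rule inj_onI)
    fix e f assume ef: "e \<in> F - F'" "f \<in> F - F'" "left_end e = left_end f"
    have "\<not> slope e < slope f" "\<not> slope f < slope e"
      using ef ex_next[of e f] ex_next[of f e] by (auto simp: F'_def)
    then show "e = f" using same_start[of e f] ef by auto
  qed
  then have "card (F - F') \<le> card V"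
    by (rule card_inj_on_le) (use left_in finV in auto)
  moreover have "card F' \<le> card (V \<times> (UNIV :: bool set))"
  proof -
    define T where "T e' p \<longleftrightarrow> fst p \<in> V \<and>
      (if snd p then nearest_above (fst p) e' else \<exists>e. next_above e e' \<and> nearest_below (fst p) e)" for e' p
    have "\<exists>p. T e' p" if e': "e' \<in> F'" for e'
    proof -
      obtain e where e: "next_above e e'" using e' by (auto simp: F'_def)
      then obtain w where "w \<in> V" "nearest_below w e \<or> nearest_above w e'"
        using wedge_closes by blast
      then have "T e' (w, False) \<or> T e' (w, True)"
        using e unfolding T_def by auto
      then show ?thesis by blast
    qed
    then obtain p where p: "\<And>e'. e' \<in> F' \<Longrightarrow> T e' (p e')" by metis
    have "inj_on p F'"
    proof (rule inj_onI)
      fix e f assume ef: "e \<in> F'" "f \<in> F'" "p e = p f"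
      then have "T e (p e)" "T f (p e)" using p[of e] p[of f] by simp_all
      then show "e = f"
        unfolding T_def
        using nearest_above_unique next_above_unique nearest_below_unique
        by (metis (full_types))
    qed
    then show ?thesis
    proof (rule card_inj_on_le)
      show "p ` F' \<subseteq> V \<times> UNIV"
      proof
        fix q assume "q \<in> p ` F'"
        then show "q \<in> V \<times> UNIV"
          using p by (auto simp: T_def mem_Times_iff simp del: split_paired_All)
      qed
    qed (use finV in simp)
  qed
  moreover have "card F = card F' + card (F - F')"
    using finF by (metis (no_types, lifting) F'_def card_Diff_subset card_mono finite_subset le_add_diff_inverse mem_Collect_eq subsetI)
  ultimately show ?thesis
    by (simp add: card_cartesian_product)
qed

end

section \<open>Crossings and rich points\<close>

text \<open>The probability \<open>m^-|A|\<close> that a random colouring is 0 on all of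
  \<open>A\<close>, cleared of denominators: points outside \<open>A\<close> keep all
  \<open>m\<close> choices.\<close>

lemma card_colourings_zero_on:
  fixes m :: nat
  assumes "finite P" "A \<subseteq> P" "m > 0"
  shows "card {f \<in> P \<rightarrow>\<^sub>E {..<m}. \<forall>p\<in>A. f p = 0} * m ^ card A = m ^ card P"
proof -
  have "f \<in> P \<rightarrow>\<^sub>E {..<m} \<and> (\<forall>p\<in>A. f p = 0) \<longleftrightarrow>
      f \<in> (\<Pi>\<^sub>E p\<in>P. if p \<in> A then {0} else {..<m})" for f
  proof -
    have "(\<forall>p\<in>P. f p < m) \<and> (\<forall>p\<in>A. f p = 0) \<longleftrightarrow> (\<forall>p\<in>P. f p \<in> (if p \<in> A then {0} else {..<m}))"
      using assms by (metis lessThan_iff singletonD singletonI subsetD)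
    then have "((\<forall>p\<in>P. f p < m) \<and> f \<in> extensional P) \<and> (\<forall>p\<in>A. f p = 0) \<longleftrightarrow>
        (\<forall>p\<in>P. f p \<in> (if p \<in> A then {0} else {..<m})) \<and> f \<in> extensional P"
      by argo
    then show ?thesis
      by (simp only: PiE_iff lessThan_iff)
  qed
  then have "{f \<in> P \<rightarrow>\<^sub>E {..<m}. \<forall>p\<in>A. f p = 0} = (\<Pi>\<^sub>E p\<in>P. if p \<in> A then {0} else {..<m})"
    by blast
  moreover have "card (\<Pi>\<^sub>E p\<in>P. if p \<in> A then {0} else {..<m}) = (\<Prod>p\<in>P. if p \<in> A then 1 else m)"
    using assms by (subst card_PiE) (auto intro!: prod.cong)
  moreover have "(\<Prod>p\<in>P. if p \<in> A then 1 else m) = m ^ card (P - A)"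
    using assms by (subst prod.If_cases) (auto simp: Diff_eq)
  moreover have "card P = card (P - A) + card A"
    using assms by (simp add: card_Diff_subset card_mono finite_subset)
  ultimately show ?thesis
    by (simp add: power_add)
qed

text \<open>Linearity of expectation, as a double count of colourings and indices.\<close>

lemma sum_colourings_zero_on:
  fixes m :: nat
  assumes "finite P" "finite I" "m > 0" "\<And>i. i \<in> I \<Longrightarrow> A i \<subseteq> P" "\<And>i. i \<in> I \<Longrightarrow> card (A i) = d"
  shows "(\<Sum>f\<in>P \<rightarrow>\<^sub>E {..<m}. card {i \<in> I. \<forall>p\<in>A i. f p = 0}) * m ^ d = card I * m ^ card P"
proof -
  have fin: "finite (P \<rightarrow>\<^sub>E {..<m})" using assms by (simp add: finite_PiE)
  have "(\<Sum>f\<in>P \<rightarrow>\<^sub>E {..<m}. card {i \<in> I. \<forall>p\<in>A i. f p = 0}) =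
      (\<Sum>i\<in>I. card {f \<in> P \<rightarrow>\<^sub>E {..<m}. \<forall>p\<in>A i. f p = 0})"
    using sum_multicount_gen[OF fin assms(2), of "\<lambda>f i. \<forall>p\<in>A i. f p = 0"
      "\<lambda>i. card {f \<in> P \<rightarrow>\<^sub>E {..<m}. \<forall>p\<in>A i. f p = 0}"] by simp
  also have "\<dots> * m ^ d = (\<Sum>i\<in>I. m ^ card P)"
    unfolding sum_distrib_right
  proof (rule sum.cong[OF refl])
    fix i assume "i \<in> I"
    then show "card {f \<in> P \<rightarrow>\<^sub>E {..<m}. \<forall>p\<in>A i. f p = 0} * m ^ d = m ^ card P"
      using card_colourings_zero_on[OF assms(1) assms(4) assms(3)] assms(5) by simp
  qed
  finally show ?thesis by simp
qed

context segment_system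
begin

definition crossing_pairs :: "(seg \<times> seg) set"
  where "crossing_pairs = {(e, f). e \<in> F \<and> f \<in> F \<and> e \<noteq> f \<and> crosses e f}"

lemma finite_crossing_pairs: "finite crossing_pairs"
  by (rule finite_subset[of _ "F \<times> F"]) (auto simp: crossing_pairs_def finF)

text \<open>Dropping every edge that takes part in a crossing inside \<open>S\<close> leaves a plane
  drawing. Since \<open>crossing_pairs\<close> holds ordered pairs, first components already cover
  all these edges.\<close>

lemma card_induced_le:
  assumes "S \<subseteq> V"
  shows "card {e \<in> F. {left_end e, right_end e} \<subseteq> S} \<le> 3 * card S +
    card {(e, f) \<in> crossing_pairs. {left_end e, right_end e, left_end f, right_end f} \<subseteq> S}"
    (is "card ?F \<le> _ + card ?X")
proof -
  have finX: "finite ?X" by (rule finite_subset[OF _ finite_crossing_pairs]) auto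
  interpret G: plane_drawing S "?F - fst ` ?X"
  proof
    show "finite S" using assms finV finite_subset by blast
    show "\<not> crosses e f" if "e \<in> ?F - fst ` ?X" "f \<in> ?F - fst ` ?X" "e \<noteq> f" for e f
      using that by (force simp: crossing_pairs_def)
  qed (use finF lft_less interior assms in auto)
  have "card ?F \<le> card ((?F - fst ` ?X) \<union> fst ` ?X)"
    by (rule card_mono) (use finF finX in auto)
  also have "\<dots> \<le> card (?F - fst ` ?X) + card (fst ` ?X)"
    by (rule card_Un_le)
  also have "card (fst ` ?X) \<le> card ?X"
    using finX by (rule card_image_le)
  finally show ?thesis using G.card_edges_le by simp
qed

text \<open>The crossing lemma, by averaging over the colour class 0 of all colourings of the vertices.\<close>

lemma crossing_inequality:
  assumes m: "m > 0"
    and four: "\<And>e f. (e, f) \<in> crossing_pairs \<Longrightarrow> card {left_end e, right_end e, left_end f, right_end f} = 4"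
  shows "m ^ 2 * card F \<le> 3 * m ^ 3 * card V + card crossing_pairs"
proof -
  let ?C = "V \<rightarrow>\<^sub>E {..<m}"
  let ?n = "m ^ card V"
  \<comment> \<open>\<open>a\<close>, \<open>b\<close> and \<open>c\<close> add up the surviving
    edges, vertices and crossings over all colourings. An edge survives with probability
    \<open>m^-2\<close>, a vertex with \<open>m^-1\<close>, and a crossing with \<open>m^-4\<close>
    because its four ends are distinct.\<close>
  define a where "a = (\<Sum>f\<in>?C. card {e \<in> F. \<forall>p\<in>{left_end e, right_end e}. f p = 0})"
  define b where "b = (\<Sum>f\<in>?C. card {v \<in> V. \<forall>p\<in>{v}. f p = 0})"
  define c where "c = (\<Sum>f\<in>?C. card {x \<in> crossing_pairs.
    \<forall>p\<in>{left_end (fst x), right_end (fst x), left_end (snd x), right_end (snd x)}. f p = 0})"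
  have "left_end e \<noteq> right_end e" if "e \<in> F" for e
    using lft_less[OF that] by (auto simp: left_end_def right_end_def)
  then have A: "a * m ^ 2 = card F * ?n"
    unfolding a_def using left_in right_in finV finF m
    by (intro sum_colourings_zero_on) auto
  have B: "b * m ^ 1 = card V * ?n"
    unfolding b_def using finV m by (intro sum_colourings_zero_on) auto
  have C: "c * m ^ 4 = card crossing_pairs * ?n"
    unfolding c_def using finV m finite_crossing_pairs left_in right_in four
    by (intro sum_colourings_zero_on) (auto simp: crossing_pairs_def)
  have "a \<le> (\<Sum>f\<in>?C. 3 * card {v \<in> V. \<forall>p\<in>{v}. f p = 0} + card {x \<in> crossing_pairs.
    \<forall>p\<in>{left_end (fst x), right_end (fst x), left_end (snd x), right_end (snd x)}. f p = 0})"
    unfolding a_def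
  proof (rule sum_mono)
    fix f assume "f \<in> ?C"
    let ?S = "{v \<in> V. f v = 0}"
    have "{e \<in> F. {left_end e, right_end e} \<subseteq> ?S} = {e \<in> F. \<forall>p\<in>{left_end e, right_end e}. f p = 0}"
      using left_in right_in by auto
    moreover have "{(e, f') \<in> crossing_pairs. {left_end e, right_end e, left_end f', right_end f'} \<subseteq> ?S} =
      {x \<in> crossing_pairs. \<forall>p\<in>{left_end (fst x), right_end (fst x), left_end (snd x), right_end (snd x)}. f p = 0}"
      using left_in right_in by (auto simp: crossing_pairs_def)
    ultimately show "card {e \<in> F. \<forall>p\<in>{left_end e, right_end e}. f p = 0} \<le> 3 * card {v \<in> V. \<forall>p\<in>{v}. f p = 0} +
      card {x \<in> crossing_pairs. \<forall>p\<in>{left_end (fst x), right_end (fst x), left_end (snd x), right_end (snd x)}. f p = 0}"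
      using card_induced_le[of ?S] by simp
  qed
  then have "a \<le> 3 * b + c"
    by (simp add: sum.distrib b_def c_def sum_distrib_left)
  then have "a * m ^ 4 \<le> (3 * b + c) * m ^ 4" by simp
  also have "\<dots> = 3 * m ^ 3 * (b * m ^ 1) + c * m ^ 4"
    by (simp add: distrib_right power3_eq_cube power4_eq_xxxx)
  also have "a * m ^ 4 = m ^ 2 * (a * m ^ 2)"
    by (simp add: power2_eq_square power4_eq_xxxx)
  finally have "(m ^ 2 * card F) * ?n \<le> (3 * m ^ 3 * card V + card crossing_pairs) * ?n"
    unfolding A B C by (simp only: distrib_right mult.assoc)
  then show ?thesis using m by simp
qed

end

section \<open>Incidences between points and lines\<close>

text \<open>A line \<open>y = m x + c\<close> is encoded as \<open>(m, c)\<close>.\<close>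

definition on_line :: "real \<times> real \<Rightarrow> real \<times> real \<Rightarrow> bool"
  where "on_line p l \<longleftrightarrow> snd p = fst l * fst p + snd l"

text \<open>The last condition makes the two ends consecutive points of \<open>P\<close> on their
  line. The gaps are the edges of a drawing with vertex set \<open>P\<close>.\<close>

definition gaps :: "(real \<times> real) set \<Rightarrow> (real \<times> real) set \<Rightarrow> seg set"
  where "gaps P L = {e. (slope e, icpt e) \<in> L \<and> lft e < rgt e \<and> left_end e \<in> P \<and> right_end e \<in> P \<and>
    (\<forall>v\<in>P. lft e < fst v \<and> fst v < rgt e \<longrightarrow> height e (fst v) \<noteq> snd v)}"

lemma segment_system_gaps:
  assumes "finite P" "finite L"
  shows "segment_system P (gaps P L)"
proof
  have "gaps P L \<subseteq> (\<lambda>(l, p, q). Seg (fst l) (snd l) (fst p) (fst q)) ` (L \<times> P \<times> P)"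
  proof
    fix e assume "e \<in> gaps P L"
    then have "((slope e, icpt e), left_end e, right_end e) \<in> L \<times> P \<times> P"
      by (auto simp: gaps_def)
    moreover have "e = (\<lambda>(l, p, q). Seg (fst l) (snd l) (fst p) (fst q)) ((slope e, icpt e), left_end e, right_end e)"
      by (simp add: left_end_def right_end_def)
    ultimately show "e \<in> (\<lambda>(l, p, q). Seg (fst l) (snd l) (fst p) (fst q)) ` (L \<times> P \<times> P)"
      by blast
  qed
  then show "finite (gaps P L)"
    by (rule finite_subset) (use assms in auto)
qed (use assms in \<open>auto simp: gaps_def\<close>)

text \<open>If the ends differed, an end of one gap would be a point of \<open>P\<close> strictly
  inside the other.\<close>

lemma gaps_same_line:
  assumes "e \<in> gaps P L" "f \<in> gaps P L" "slope e = slope f" "icpt e = icpt f"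
    and "lft e < x" "x < rgt e" "lft f < x" "x < rgt f"
  shows "e = f"
proof -
  have h: "height e = height f" using assms by (auto simp: height_def)
  have 1: "\<not> (lft e < fst v \<and> fst v < rgt e)" if "v \<in> P" "height e (fst v) = snd v" for v
    using that assms by (auto simp: gaps_def)
  have 2: "\<not> (lft f < fst v \<and> fst v < rgt f)" if "v \<in> P" "height e (fst v) = snd v" for v
    using that assms h by (auto simp: gaps_def)
  have P: "left_end e \<in> P" "right_end e \<in> P" "left_end f \<in> P" "right_end f \<in> P"
    using assms by (auto simp: gaps_def)
  have "lft e = lft f"
    using 1[OF P(3)] 2[OF P(1)] assms h by (auto simp: left_end_def)
  moreover have "rgt e = rgt f"
    using 1[OF P(4)] 2[OF P(2)] assms h by (auto simp: right_end_def)
  ultimately show ?thesis using assms by (simp add: seg.expand)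
qed

lemma crosses_unique:
  assumes "height e x = height f x" "height e y = height f y" "\<not> (slope e = slope f \<and> icpt e = icpt f)"
  shows "x = y"
proof -
  have "(slope e - slope f) * (x - y) = 0"
    using assms by (simp add: height_def algebra_simps)
  then show ?thesis using assms by (auto simp: height_def)
qed

text \<open>Two different lines meet at most once, and the meeting point is interior to at most one
  gap of each; so a crossing is determined by its pair of lines.\<close>

lemma card_crossing_pairs_gaps:
  assumes "finite P" "finite L"
  shows "card (segment_system.crossing_pairs (gaps P L)) \<le> card L ^ 2"
proof -
  interpret segment_system P "gaps P L" by (rule segment_system_gaps[OF assms])
  let ?g = "\<lambda>(e, f). ((slope e, icpt e), (slope f, icpt f))"
  have "inj_on ?g crossing_pairs"
  proof (rule inj_onI, clarify)
    fix e f e' f'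
    assume ef: "(e, f) \<in> crossing_pairs" "(e', f') \<in> crossing_pairs"
      and eq: "slope e = slope e'" "icpt e = icpt e'" "slope f = slope f'" "icpt f = icpt f'"
    have G: "e \<in> gaps P L" "f \<in> gaps P L" "e' \<in> gaps P L" "f' \<in> gaps P L"
      using ef by (auto simp: crossing_pairs_def)
    obtain x where x: "lft e < x" "x < rgt e" "lft f < x" "x < rgt f" "height e x = height f x"
      using ef by (auto simp: crossing_pairs_def crosses_def)
    obtain y where y: "lft e' < y" "y < rgt e'" "lft f' < y" "y < rgt f'" "height e' y = height f' y"
      using ef by (auto simp: crossing_pairs_def crosses_def)
    have "\<not> (slope e = slope f \<and> icpt e = icpt f)"
      using gaps_same_line[OF G(1,2)] x ef by (auto simp: crossing_pairs_def)
    moreover have "height e y = height f y" using y eq by (simp add: height_def)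
    ultimately have "x = y" using crosses_unique x by blast
    then show "e = e' \<and> f = f'"
      using gaps_same_line[OF G(1,3)] gaps_same_line[OF G(2,4)] x y eq by auto
  qed
  then have "card crossing_pairs \<le> card (L \<times> L)"
  proof (rule card_inj_on_le)
    have "(slope e, icpt e) \<in> L" if "e \<in> gaps P L" for e
      using that by (simp add: gaps_def)
    then show "?g ` crossing_pairs \<subseteq> L \<times> L"
      by (auto simp: crossing_pairs_def)
  qed (use assms in simp)
  then show ?thesis by (simp add: card_cartesian_product power2_eq_square)
qed

text \<open>The carrying lines differ and meet only at a point interior to both segments, so no end
  of one is an end of the other. This supplies the distinctness needed by
  \<open>crossing_inequality\<close>.\<close>

lemma card_ends_crossing_gaps:
  assumes "finite P" "finite L" "(e, f) \<in> segment_system.crossing_pairs (gaps P L)"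
  shows "card {left_end e, right_end e, left_end f, right_end f} = 4"
proof -
  interpret segment_system P "gaps P L" by (rule segment_system_gaps[OF assms(1,2)])
  have G: "e \<in> gaps P L" "f \<in> gaps P L" "e \<noteq> f" and "crosses e f"
    using assms(3) by (auto simp: crossing_pairs_def)
  then obtain x where x: "lft e < x" "x < rgt e" "lft f < x" "x < rgt f" "height e x = height f x"
    by (auto simp: crosses_def)
  have nl: "\<not> (slope e = slope f \<and> icpt e = icpt f)"
    using gaps_same_line[OF G(1,2)] x G by auto
  have *: "height e y \<noteq> height f y" if "y \<noteq> x" for y
    using crosses_unique[OF x(5) _ nl] that by blast
  have "left_end e \<noteq> right_end e" "left_end f \<noteq> right_end f"
    using x by (auto simp: left_end_def right_end_def)
  moreover have "left_end e \<noteq> left_end f" "left_end e \<noteq> right_end f"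
      "right_end e \<noteq> left_end f" "right_end e \<noteq> right_end f"
    using *[of "lft e"] *[of "rgt e"] x by (auto simp: left_end_def right_end_def)
  ultimately show ?thesis by simp
qed

text \<open>Every point of \<open>P\<close> on a line, except the leftmost, is the right end of the
  gap before it; the leftmost points cost at most one per line.\<close>

lemma card_incidences_le:
  assumes "finite P" "finite L"
  shows "card {(p, l). p \<in> P \<and> l \<in> L \<and> on_line p l} \<le> card (gaps P L) + card L"
proof -
  let ?I = "{(p, l). p \<in> P \<and> l \<in> L \<and> on_line p l}"
  \<comment> \<open>On lines that miss \<open>P\<close> the choice is arbitrary, which only enlarges
    the covering set.\<close>
  define first where "first l = (SOME p. p \<in> P \<and> on_line p l \<and> (\<forall>q\<in>P. on_line q l \<longrightarrow> fst p \<le> fst q))" for l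
  interpret segment_system P "gaps P L" by (rule segment_system_gaps[OF assms])
  have "?I \<subseteq> (\<lambda>e. (right_end e, (slope e, icpt e))) ` gaps P L \<union> (\<lambda>l. (first l, l)) ` L"
  proof
    fix x assume "x \<in> ?I"
    then obtain p l where x: "x = (p, l)" "p \<in> P" "l \<in> L" "on_line p l" by blast
    define B where "B = {q \<in> P. on_line q l \<and> fst q < fst p}"
    have "finite B" using assms by (simp add: B_def)
    show "x \<in> (\<lambda>e. (right_end e, (slope e, icpt e))) ` gaps P L \<union> (\<lambda>l. (first l, l)) ` L"
    proof (cases "B = {}")
      case True
      then have "p \<in> P \<and> on_line p l \<and> (\<forall>q\<in>P. on_line q l \<longrightarrow> fst p \<le> fst q)"
        using x unfolding B_def by (metis (mono_tags, lifting) empty_Collect_eq not_le)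
      then have "\<exists>p. p \<in> P \<and> on_line p l \<and> (\<forall>q\<in>P. on_line q l \<longrightarrow> fst p \<le> fst q)" ..
      then have "first l \<in> P \<and> on_line (first l) l \<and> (\<forall>q\<in>P. on_line q l \<longrightarrow> fst (first l) \<le> fst q)"
        unfolding first_def by (rule someI_ex)
      moreover from this have "fst (first l) = fst p"
        using True x unfolding B_def by (metis (mono_tags, lifting) empty_Collect_eq order_le_less)
      ultimately have "first l = p"
        using x by (auto simp: on_line_def prod_eq_iff)
      then show ?thesis using x by auto
    next
      case False
      then obtain q where q: "q \<in> B" "\<And>u. u \<in> B \<Longrightarrow> fst u \<le> fst q"
        using arg_min_if_finite[OF \<open>finite B\<close>, of "\<lambda>u. - fst u"] by (metis neg_less_iff_less not_le)
      define e where "e = Seg (fst l) (snd l) (fst q) (fst p)"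
      have pe: "right_end e = p" and qe: "left_end e = q"
        using q x by (auto simp: e_def right_end_def left_end_def height_def on_line_def B_def prod_eq_iff)
      have "e \<in> gaps P L"
        unfolding gaps_def mem_Collect_eq pe qe
      proof (intro conjI ballI impI)
        fix v assume v: "v \<in> P" "lft e < fst v \<and> fst v < rgt e"
        then have "v \<notin> B" using q(2)[of v] by (auto simp: e_def)
        then show "height e (fst v) \<noteq> snd v"
          using v x by (simp add: B_def e_def height_def on_line_def)
      qed (use q x in \<open>auto simp: e_def B_def\<close>)
      moreover have "x = (right_end e, (slope e, icpt e))"
        using pe x by (simp add: e_def)
      ultimately show ?thesis by blast
    qed
  qed
  then have "card ?I \<le> card ((\<lambda>e. (right_end e, (slope e, icpt e))) ` gaps P L \<union> (\<lambda>l. (first l, l)) ` L)"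
    by (rule card_mono[rotated]) (use finF assms in auto)
  also have "\<dots> \<le> card ((\<lambda>e. (right_end e, (slope e, icpt e))) ` gaps P L) + card ((\<lambda>l. (first l, l)) ` L)"
    by (rule card_Un_le)
  also have "\<dots> \<le> card (gaps P L) + card L"
    using finF assms by (intro add_mono card_image_le) auto
  finally show ?thesis .
qed

text \<open>The Szemeredi-Trotter theorem in its rich-points form.\<close>

lemma card_rich_points_le:
  assumes P: "finite P" and L: "finite L" and t: "t \<ge> 6"
    and rich: "\<And>p. p \<in> P \<Longrightarrow> t \<le> card {l \<in> L. on_line p l}"
  shows "card P * t ^ 3 \<le> 2 * card L * t ^ 2 + 288 * card L ^ 2"
proof -
  interpret segment_system P "gaps P L" by (rule segment_system_gaps[OF P L])
  \<comment> \<open>\<open>6 * m \<le> t\<close> makes the vertex term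
    \<open>3 * m ^ 3 * card P\<close> at most half of \<open>m ^ 2 * (card P * t)\<close>, so it can
    be absorbed. \<open>t \<le> 12 * m\<close> turns powers of \<open>m\<close> back into powers of
    \<open>t\<close>, whence 288 = 2 * 144.\<close>
  define m where "m = t div 6"
  have m: "m > 0" "6 * m \<le> t" "t \<le> 12 * m" using t unfolding m_def by presburger+
  have "card P * t = (\<Sum>p\<in>P. t)" by simp
  also have "\<dots> \<le> (\<Sum>p\<in>P. card {l \<in> L. on_line p l})"
    by (rule sum_mono) (rule rich)
  also have "\<dots> = card (SIGMA p:P. {l \<in> L. on_line p l})"
    using P L by (intro card_SigmaI[symmetric]) auto
  also have "(SIGMA p:P. {l \<in> L. on_line p l}) = {(p, l). p \<in> P \<and> l \<in> L \<and> on_line p l}"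
    by auto
  finally have inc: "card P * t \<le> card (gaps P L) + card L"
    using card_incidences_le[OF P L] by linarith
  have "m ^ 2 * card (gaps P L) \<le> 3 * m ^ 3 * card P + card L ^ 2"
    using crossing_inequality[OF m(1) card_ends_crossing_gaps[OF P L]]
      card_crossing_pairs_gaps[OF P L] by linarith
  then have "m ^ 2 * (card P * t) \<le> 3 * m ^ 3 * card P + card L ^ 2 + m ^ 2 * card L"
    using mult_left_mono[OF inc, of "m ^ 2"] by (simp add: distrib_left)
  moreover have "2 * (3 * m ^ 3 * card P) \<le> m ^ 2 * (card P * t)"
  proof -
    have "2 * (3 * m ^ 3 * card P) = m ^ 2 * (card P * (6 * m))"
      by (simp add: power2_eq_square power3_eq_cube)
    also have "\<dots> \<le> m ^ 2 * (card P * t)" by (intro mult_left_mono m) auto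
    finally show ?thesis .
  qed
  ultimately have *: "m ^ 2 * (card P * t) \<le> 2 * card L ^ 2 + 2 * (m ^ 2 * card L)"
    by linarith
  have "t ^ 2 \<le> 144 * m ^ 2"
    using power_mono[OF m(3), of 2] by (simp add: power_mult_distrib)
  have "m ^ 2 * (card P * t ^ 3) = (m ^ 2 * (card P * t)) * t ^ 2"
    by (simp add: power2_eq_square power3_eq_cube)
  also have "\<dots> \<le> (2 * card L ^ 2 + 2 * (m ^ 2 * card L)) * t ^ 2"
    by (rule mult_right_mono[OF *]) simp
  also have "\<dots> = 2 * card L ^ 2 * t ^ 2 + m ^ 2 * (2 * card L * t ^ 2)"
    by (simp add: algebra_simps)
  also have "\<dots> \<le> 2 * card L ^ 2 * (144 * m ^ 2) + m ^ 2 * (2 * card L * t ^ 2)"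
    by (intro add_right_mono mult_left_mono \<open>t ^ 2 \<le> 144 * m ^ 2\<close>) simp
  also have "\<dots> = m ^ 2 * (2 * card L * t ^ 2 + 288 * card L ^ 2)"
    by (simp add: algebra_simps)
  finally show ?thesis using m by simp
qed

section \<open>Rich rigid motions\<close>

text \<open>With \<open>c = 1 + \<i> x\<close>, each nonzero \<open>z\<close> rules out at most the
  two ratios as values of \<open>x\<close>. Real parts will separate slopes and motions, imaginary
  parts intercepts.\<close>

lemma generic_multiplier:
  fixes Z :: "complex set"
  assumes "finite Z"
  shows "\<exists>c. \<forall>z\<in>Z. z \<noteq> 0 \<longrightarrow> Re (c * z) \<noteq> 0 \<and> Im (c * z) \<noteq> 0"
proof -
  obtain x where x: "x \<notin> (\<lambda>z. Re z / Im z) ` Z \<union> (\<lambda>z. - Im z / Re z) ` Z"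
    using ex_new_if_finite[OF infinite_UNIV_char_0, of "(\<lambda>z. Re z / Im z) ` Z \<union> (\<lambda>z. - Im z / Re z) ` Z"]
      assms by auto
  have "Re (Complex 1 x * z) \<noteq> 0 \<and> Im (Complex 1 x * z) \<noteq> 0" if z: "z \<in> Z" "z \<noteq> 0" for z
  proof -
    have "x \<noteq> Re z / Im z" "x \<noteq> - Im z / Re z" using x z by blast+
    then show ?thesis
      using z(2) by (cases "Re z = 0"; cases "Im z = 0") (auto simp: complex_eq_iff field_simps)
  qed
  then show ?thesis by blast
qed

text \<open>
  For real \<open>s\<close> the pair \<open>(s, w)\<close> stands for the motion \<open>z \<mapsto> ((s + \<i>) z + w) / (s - \<i>)\<close>; as \<open>s\<close>
  varies, the rotation factor takes every value on the unit circle except 1. In these coordinates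
  the motions taking \<open>a\<close> to \<open>b\<close> form the line \<open>w = s (b - a) - \<i> (a + b)\<close>.
\<close>

definition matched :: "complex set \<Rightarrow> real \<times> complex \<Rightarrow> (complex \<times> complex) set"
  where "matched A g = {(a, b) \<in> A \<times> A. b * (of_real (fst g) - \<i>) = a * (of_real (fst g) + \<i>) + snd g}"

definition rich_motions :: "complex set \<Rightarrow> nat \<Rightarrow> (real \<times> complex) set"
  where "rich_motions A t = {g. t \<le> card (matched A g)}"

lemma matched_iff:
  "(a, b) \<in> matched A g \<longleftrightarrow> a \<in> A \<and> b \<in> A \<and> snd g = of_real (fst g) * (b - a) - \<i> * (a + b)"
  by (auto simp: matched_def algebra_simps)

lemma finite_matched: "finite A \<Longrightarrow> finite (matched A g)"
  by (rule finite_subset[of _ "A \<times> A"]) (auto simp: matched_def)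

lemma of_real_minus_ii_nonzero: "of_real s - \<i> \<noteq> 0"
  by (simp add: complex_eq_iff)

lemma card_matched_le:
  assumes "finite A"
  shows "card (matched A g) \<le> card A"
proof (rule card_inj_on_le)
  show "inj_on fst (matched A g)"
  proof (rule inj_onI, clarsimp)
    fix a b b' assume "(a, b) \<in> matched A g" "(a, b') \<in> matched A g"
    then have "b * (of_real (fst g) - \<i>) = b' * (of_real (fst g) - \<i>)"
      by (auto simp: matched_def)
    then show "b = b'" using of_real_minus_ii_nonzero by simp
  qed
qed (use assms in \<open>auto simp: matched_def\<close>)

lemma sum_diff_eqD:
  fixes a b c d :: complex
  assumes "(b - a) - (d - c) = 0" "(a + b) - (c + d) = 0"
  shows "a = c" "b = d"
  using assms by (simp_all add: complex_eq_iff)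

text \<open>Eliminating the second coordinate between the two line equations leaves a linear
  equation for the first. If its coefficient vanished, so would its right-hand side, and the two
  pairs would coincide.\<close>

lemma motion_determined:
  assumes "(a, b) \<in> matched A g" "(c, d) \<in> matched A g" "(a, b) \<in> matched A h" "(c, d) \<in> matched A h"
    and ne: "(a, b) \<noteq> (c, d)"
  shows "g = h"
proof -
  have *: "of_real (fst f) * ((b - a) - (d - c)) = \<i> * ((a + b) - (c + d))"
    if "(a, b) \<in> matched A f" "(c, d) \<in> matched A f" for f
  proof -
    have "of_real (fst f) * (b - a) - \<i> * (a + b) = of_real (fst f) * (d - c) - \<i> * (c + d)"
      using that by (metis matched_iff)
    then show ?thesis by algebra
  qed
  note g = *[OF assms(1,2)] and h = *[OF assms(3,4)]
  have D: "(b - a) - (d - c) \<noteq> 0"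
  proof
    assume "(b - a) - (d - c) = 0"
    moreover from this have "(a + b) - (c + d) = 0" using g by simp
    ultimately show False using ne sum_diff_eqD by blast
  qed
  have "of_real (fst g) * ((b - a) - (d - c)) = of_real (fst h) * ((b - a) - (d - c))"
    using g h by simp
  then have "fst g = fst h" using D by simp
  moreover have "snd g = snd h" using assms \<open>fst g = fst h\<close> by (simp add: matched_iff)
  ultimately show ?thesis by (simp add: prod_eq_iff)
qed

text \<open>Two matched pairs determine the motion. Finiteness allows sums over motions, and the
  crude count serves for small richness.\<close>

lemma rich_motions_2:
  assumes A: "finite A"
  shows "finite (rich_motions A 2)" "card (rich_motions A 2) \<le> card A ^ 4"
proof -
  define I where "I = {(p, q). p \<in> A \<times> A \<and> q \<in> A \<times> A \<and> p \<noteq> q}"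
  define G where "G x = {g. fst x \<in> matched A g \<and> snd x \<in> matched A g}" for x
  have I_sub: "I \<subseteq> (A \<times> A) \<times> (A \<times> A)" by (auto simp: I_def)
  then have finI: "finite I" by (rule finite_subset) (use A in simp)
  have "\<exists>g. G x \<subseteq> {g}" if "x \<in> I" for x
  proof -
    have "g = h" if "g \<in> G x" "h \<in> G x" for g h
    proof -
      obtain a b c d where x: "x = ((a, b), (c, d))" by (metis surj_pair)
      then have "(a, b) \<noteq> (c, d)" using \<open>x \<in> I\<close> by (simp add: I_def)
      then show ?thesis
        using motion_determined[of a b A g c d h] that unfolding G_def x by simp
    qed
    then show ?thesis by blast
  qed
  then have G: "finite (G x)" "card (G x) \<le> 1" if x: "x \<in> I" for x
  proof -
    obtain g where "G x \<subseteq> {g}" using \<open>\<And>x. x \<in> I \<Longrightarrow> \<exists>g. G x \<subseteq> {g}\<close>[OF x] by blast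
    then show "finite (G x)" "card (G x) \<le> 1"
      using finite_subset card_mono[of "{g}" "G x"] by auto
  qed
  have sub: "rich_motions A 2 \<subseteq> (\<Union>x\<in>I. G x)"
  proof
    fix g assume "g \<in> rich_motions A 2"
    then have "\<not> card (matched A g) \<le> 1" by (simp add: rich_motions_def)
    then obtain p q where "p \<in> matched A g" "q \<in> matched A g" "p \<noteq> q"
      using finite_matched[OF A, of g] card_le_Suc0_iff_eq[of "matched A g"] by auto
    then have "(p, q) \<in> I" "g \<in> G (p, q)" by (auto simp: I_def G_def matched_def)
    then show "g \<in> (\<Union>x\<in>I. G x)" by blast
  qed
  have fin: "finite (\<Union>x\<in>I. G x)" using finI G by blast
  then show "finite (rich_motions A 2)" using sub finite_subset by blast
  have "card (rich_motions A 2) \<le> card (\<Union>x\<in>I. G x)" using fin sub by (rule card_mono)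
  also have "\<dots> \<le> (\<Sum>x\<in>I. card (G x))" using finI by (rule card_UN_le)
  also have "\<dots> \<le> (\<Sum>x\<in>I. 1)" using G by (intro sum_mono) auto
  also have "\<dots> = card I" by simp
  also have "\<dots> \<le> card ((A \<times> A) \<times> (A \<times> A))" using I_sub A by (intro card_mono) auto
  finally show "card (rich_motions A 2) \<le> card A ^ 4"
    by (simp add: card_cartesian_product power4_eq_xxxx)
qed

text \<open>The incidence bound needs \<open>6 \<le> t\<close>; below that the crude count suffices
  as \<open>5 ^ 3 \<le> 290\<close>, and richness above \<open>card A\<close> is impossible. For
  \<open>t \<le> card A\<close> the term linear in the number of lines is absorbed, whence 290 = 2 +
  288.\<close>

lemma card_rich_motions_le:
  assumes A: "finite A"
  shows "card {g \<in> rich_motions A 2. t \<le> card (matched A g)} * t ^ 3 \<le> 290 * card A ^ 4"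
    (is "card ?R * _ \<le> _")
proof -
  have finR: "finite ?R" using rich_motions_2[OF A] by auto
  consider "t \<le> 5" | "t \<ge> 6" "t > card A" | "t \<ge> 6" "t \<le> card A" by linarith
  then show ?thesis
  proof cases
    case 1
    have "card ?R \<le> card (rich_motions A 2)"
      by (rule card_mono) (use rich_motions_2[OF A] in auto)
    then have "card ?R * t ^ 3 \<le> card A ^ 4 * 5 ^ 3"
      using rich_motions_2[OF A] 1 by (intro mult_mono power_mono) linarith+
    then show ?thesis by simp
  next
    case 2
    then have "\<not> t \<le> card (matched A g)" for g
      using card_matched_le[OF A, of g] by linarith
    then have "?R = {}" by blast
    then show ?thesis by (metis card.empty mult_0 zero_le)
  next
    case 3
    \<comment> \<open>All differences that the projection must not annihilate: of line directions,
      of line offsets, and of second coordinates of motions.\<close>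
    define Z where "Z = (\<lambda>((a, b), (c, d)). (b - a) - (d - c)) ` ((A \<times> A) \<times> (A \<times> A)) \<union>
      (\<lambda>((a, b), (c, d)). (a + b) - (c + d)) ` ((A \<times> A) \<times> (A \<times> A)) \<union> (\<lambda>(g, h). snd g - snd h) ` (?R \<times> ?R)"
    have "finite Z" unfolding Z_def using A finR by (intro finite_UnI finite_imageI finite_cartesian_product)
    then obtain c where c: "\<And>z. z \<in> Z \<Longrightarrow> z \<noteq> 0 \<Longrightarrow> Re (c * z) \<noteq> 0 \<and> Im (c * z) \<noteq> 0"
      using generic_multiplier by blast
    define pt where "pt g = (fst g, Re (c * snd g))" for g :: "real \<times> complex"
    \<comment> \<open>Slope and intercept of the projected line; the intercept is an imaginary part
      since \<open>Re (- \<i> * z) = Im z\<close>.\<close>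
    define ln where "ln p = (Re (c * (snd p - fst p)), Im (c * (fst p + snd p)))" for p :: "complex \<times> complex"
    have "inj_on pt ?R"
    proof (rule inj_onI)
      fix g h assume gh: "g \<in> ?R" "h \<in> ?R" "pt g = pt h"
      have "snd g - snd h \<in> Z"
        unfolding Z_def by (intro UnI2 image_eqI[of _ _ "(g, h)"]) (use gh in auto)
      moreover have "Re (c * (snd g - snd h)) = 0"
        using gh by (simp add: pt_def right_diff_distrib)
      ultimately have "snd g - snd h = 0" using c by blast
      then show "g = h" using gh by (simp add: pt_def prod_eq_iff)
    qed
    have inj_ln: "inj_on ln (A \<times> A)"
    proof (rule inj_onI)
      fix p q assume pq: "p \<in> A \<times> A" "q \<in> A \<times> A" "ln p = ln q"
      obtain a b a' b' where [simp]: "p = (a, b)" "q = (a', b')" by (metis surj_pair)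
      have "(b - a) - (b' - a') \<in> Z"
        unfolding Z_def by (rule UnI1, rule UnI1, rule image_eqI[of _ _ "(p, q)"]) (use pq in auto)
      moreover have "Re (c * ((b - a) - (b' - a'))) = 0"
        using pq(3) by (auto simp: ln_def algebra_simps)
      ultimately have 1: "(b - a) - (b' - a') = 0"
        using c by blast
      have "(a + b) - (a' + b') \<in> Z"
        unfolding Z_def by (rule UnI1, rule UnI2, rule image_eqI[of _ _ "(p, q)"]) (use pq in auto)
      moreover have "Im (c * ((a + b) - (a' + b'))) = 0"
        using pq(3) by (auto simp: ln_def algebra_simps)
      ultimately have "(a + b) - (a' + b') = 0"
        using c by blast
      with 1 show "p = q" using sum_diff_eqD[of b a b' a'] by simp
    qed
    have "card (pt ` ?R) * t ^ 3 \<le> 2 * card (ln ` (A \<times> A)) * t ^ 2 + 288 * card (ln ` (A \<times> A)) ^ 2"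
    proof (rule card_rich_points_le)
      fix p assume "p \<in> pt ` ?R"
      then obtain g where g: "g \<in> ?R" "p = pt g" by blast
      have sub: "ln ` matched A g \<subseteq> {l \<in> ln ` (A \<times> A). on_line p l}"
      proof
        fix l assume "l \<in> ln ` matched A g"
        then obtain a b where ab: "(a, b) \<in> matched A g" "l = ln (a, b)" by auto
        then have "snd g = of_real (fst g) * (b - a) - \<i> * (a + b)" by (simp add: matched_iff)
        then have w: "Re (snd g) = fst g * (Re b - Re a) + (Im a + Im b)"
          "Im (snd g) = fst g * (Im b - Im a) - (Re a + Re b)"
          by simp_all
        have "on_line p l"
          unfolding g(2) ab(2) on_line_def pt_def ln_def by (simp add: w algebra_simps)
        then show "l \<in> {l \<in> ln ` (A \<times> A). on_line p l}"
          using ab by (auto simp: matched_def)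
      qed
      have "t \<le> card (matched A g)" using g by simp
      also have "\<dots> = card (ln ` matched A g)"
        by (rule card_image[symmetric], rule inj_on_subset[OF inj_ln]) (auto simp: matched_def)
      also have "\<dots> \<le> card {l \<in> ln ` (A \<times> A). on_line p l}"
        by (rule card_mono[OF _ sub]) (use A in auto)
      finally show "t \<le> card {l \<in> ln ` (A \<times> A). on_line p l}" .
    qed (use finR A 3 in auto)
    moreover have "card (pt ` ?R) = card ?R" by (rule card_image) fact
    moreover have "card (ln ` (A \<times> A)) = card A ^ 2"
      using card_image[OF inj_ln] by (simp add: card_cartesian_product power2_eq_square)
    ultimately have "card ?R * t ^ 3 \<le> 2 * card A ^ 2 * t ^ 2 + 288 * (card A ^ 2) ^ 2"
      by simp
    also have "\<dots> \<le> 2 * card A ^ 2 * card A ^ 2 + 288 * (card A ^ 2) ^ 2"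
      by (intro add_right_mono mult_left_mono power_mono 3) auto
    also have "\<dots> = 290 * card A ^ 4"
      by (simp add: power2_eq_square power4_eq_xxxx)
    finally show ?thesis .
  qed
qed

text \<open>\<open>t ^ 3 - (t - 1) ^ 3 \<le> 3 * t ^ 2\<close>; this splits a third moment into
  layers by richness.\<close>

lemma cube_le_sum_squares: "n ^ 3 \<le> (\<Sum>t=1..n. 3 * t ^ 2)" for n :: nat
proof (induction n)
  case (Suc n)
  have "Suc n ^ 3 \<le> n ^ 3 + 3 * Suc n ^ 2"
    by (simp add: power2_eq_square power3_eq_cube algebra_simps)
  with Suc show ?case by simp
qed simp

text \<open>The layer \<open>t\<close> has weight \<open>3 * t ^ 2\<close> and at most
  \<open>290 * card A ^ 4 / t ^ 3\<close> motions, so it contributes at most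
  \<open>870 * card A ^ 4 / t\<close>.\<close>

lemma sum_matched_cubes_le:
  assumes A: "finite A"
  shows "real (\<Sum>g\<in>rich_motions A 2. card (matched A g) ^ 3) \<le>
    870 * real (card A) ^ 4 * (\<Sum>t=1..card A. 1 / real t)"
proof -
  let ?r = "\<lambda>g. card (matched A g)"
  let ?G = "rich_motions A 2"
  let ?N = "\<lambda>t. card {g \<in> ?G. t \<le> ?r g}"
  have "(\<Sum>g\<in>?G. ?r g ^ 3) \<le> (\<Sum>g\<in>?G. \<Sum>t | t \<in> {1..card A} \<and> t \<le> ?r g. 3 * t ^ 2)"
  proof (rule sum_mono)
    fix g
    have "{t. t \<in> {1..card A} \<and> t \<le> ?r g} = {1..?r g}"
      using card_matched_le[OF A, of g] by auto
    then show "?r g ^ 3 \<le> (\<Sum>t | t \<in> {1..card A} \<and> t \<le> ?r g. 3 * t ^ 2)"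
      using cube_le_sum_squares[of "?r g"] by simp
  qed
  also have "\<dots> = (\<Sum>t=1..card A. \<Sum>g | g \<in> ?G \<and> t \<le> ?r g. 3 * t ^ 2)"
    by (rule sum.swap_restrict) (use rich_motions_2[OF A] in auto)
  also have "\<dots> = (\<Sum>t=1..card A. ?N t * (3 * t ^ 2))" by simp
  finally have "real (\<Sum>g\<in>?G. ?r g ^ 3) \<le> real (\<Sum>t=1..card A. ?N t * (3 * t ^ 2))"
    by (rule of_nat_mono)
  also have "\<dots> = (\<Sum>t=1..card A. real (?N t * (3 * t ^ 2)))" by (rule of_nat_sum)
  also have "\<dots> \<le> (\<Sum>t=1..card A. 870 * real (card A) ^ 4 * (1 / real t))"
  proof (rule sum_mono)
    fix t assume "t \<in> {1..card A}"
    then have t: "real t > 0" by simp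
    have "real (?N t * t ^ 3) \<le> real (290 * card A ^ 4)"
      using card_rich_motions_le[OF A, of t] by (rule of_nat_mono)
    then have "real (?N t) * (3 * real t ^ 2) * real t \<le> 870 * real (card A) ^ 4"
      by (simp add: power2_eq_square power3_eq_cube mult_ac)
    then show "real (?N t * (3 * t ^ 2)) \<le> 870 * real (card A) ^ 4 * (1 / real t)"
      using t by (simp add: pos_le_divide_eq)
  qed
  also have "\<dots> = 870 * real (card A) ^ 4 * (\<Sum>t=1..card A. 1 / real t)"
    by (rule sum_distrib_left[symmetric])
  finally show ?thesis .
qed

text \<open>Write \<open>1 / t = t powr (- 1 - \<epsilon>) * t powr \<epsilon>\<close>, bound the
  last factor by \<open>n powr \<epsilon>\<close> and sum the convergent series.\<close>

lemma harmonic_le_powr: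
  fixes \<epsilon> :: real
  assumes "\<epsilon> > 0"
  shows "\<exists>Z\<ge>0. \<forall>n. (\<Sum>t=1..n. 1 / real t) \<le> Z * real n powr \<epsilon>"
proof -
  define z where "z t = real t powr (- 1 - \<epsilon>)" for t
  have z: "summable z" "\<And>t. z t \<ge> 0"
    using assms summable_real_powr_iff[of "- 1 - \<epsilon>"] by (auto simp: z_def[abs_def])
  have "(\<Sum>t=1..n. 1 / real t) \<le> suminf z * real n powr \<epsilon>" for n
  proof -
    have "(\<Sum>t=1..n. 1 / real t) \<le> (\<Sum>t=1..n. z t * real n powr \<epsilon>)"
    proof (rule sum_mono)
      fix t assume t: "t \<in> {1..n}"
      then have "1 / real t = z t * real t powr \<epsilon>"
        by (simp add: z_def powr_add[symmetric] powr_minus_divide)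
      also have "\<dots> \<le> z t * real n powr \<epsilon>"
        using t assms z(2) by (intro mult_left_mono powr_mono2) auto
      finally show "1 / real t \<le> z t * real n powr \<epsilon>" .
    qed
    also have "\<dots> = (\<Sum>t=1..n. z t) * real n powr \<epsilon>" by (rule sum_distrib_right[symmetric])
    also have "\<dots> \<le> suminf z * real n powr \<epsilon>"
      by (intro mult_right_mono sum_le_suminf) (use z in auto)
    finally show ?thesis .
  qed
  moreover have "suminf z \<ge> 0" by (rule suminf_nonneg) (use z in auto)
  ultimately show ?thesis by blast
qed

section \<open>Congruence classes of tuples\<close>

definition to_complex :: "real^2 \<Rightarrow> complex"
  where "to_complex x = Complex (x $ 1) (x $ 2)"

lemma to_complex_eq_iff: "to_complex x = to_complex y \<longleftrightarrow> x = y"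
  by (simp add: to_complex_def vec_eq_iff forall_2)

lemma inj_to_complex: "inj to_complex"
  by (simp add: inj_def to_complex_eq_iff)

lemma to_complex_add: "to_complex (x + y) = to_complex x + to_complex y"
  by (simp add: to_complex_def complex_eq_iff)

lemma rotation_matrix_to_complex:
  fixes \<theta> :: "real^2^2"
  assumes "rotation_matrix \<theta>"
  shows "\<exists>u. norm u = 1 \<and> (\<forall>x. to_complex (\<theta> *v x) = u * to_complex x)"
proof -
  define a b c d where "a = \<theta>$1$1" and "b = \<theta>$1$2" and "c = \<theta>$2$1" and "d = \<theta>$2$2"
  have "transpose \<theta> ** \<theta> = mat 1" and det: "a * d - b * c = 1"
    using assms by (auto simp: rotation_matrix_def orthogonal_matrix_def det_2 a_def b_def c_def d_def)
  then have "(transpose \<theta> ** \<theta>) $ i $ j = mat 1 $ i $ j" for i j by simp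
  from this[of 1 1] this[of 2 2]
  have sq: "a\<^sup>2 + c\<^sup>2 = 1" "b\<^sup>2 + d\<^sup>2 = 1"
    by (simp_all add: matrix_matrix_mult_def transpose_def mat_def sum_2 a_def b_def c_def d_def power2_eq_square)
  \<comment> \<open>Expanding gives the squared lengths of the two columns minus twice the
    determinant, 1 + 1 - 2. Here determinant 1 rules out reflections.\<close>
  have "(a - d)\<^sup>2 + (b + c)\<^sup>2 = 0"
    using sq det by (simp add: power2_eq_square algebra_simps)
  then have *: "d = a" "b = - c"
    by (auto simp: sum_power2_eq_zero_iff)
  have "norm (Complex a c) = 1" using sq by (simp add: cmod_def)
  moreover have "to_complex (\<theta> *v x) = Complex a c * to_complex x" for x
  proof -
    have "(\<theta> *v x) $ 1 = a * x$1 + b * x$2" "(\<theta> *v x) $ 2 = c * x$1 + d * x$2"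
      by (simp_all add: matrix_vector_mult_def sum_2 a_def b_def c_def d_def)
    then show ?thesis by (simp add: to_complex_def complex_eq_iff *)
  qed
  ultimately show ?thesis by blast
qed

lemma congruence_to_complex:
  assumes "(x, y) \<in> congruence k"
  shows "\<exists>u w. norm u = 1 \<and> (\<forall>j\<in>{1..k+1}. to_complex (y j) = u * to_complex (x j) + w)"
proof -
  obtain \<theta> :: "real^2^2" and \<tau> where "rotation_matrix \<theta>" and y: "\<And>j. j \<in> {1..k+1} \<Longrightarrow> y j = \<theta> *v x j + \<tau>"
    using assms unfolding congruence_def by blast
  then obtain u where "norm u = 1" "\<And>x. to_complex (\<theta> *v x) = u * to_complex x"
    using rotation_matrix_to_complex by blast
  then show ?thesis
    using y by (intro exI[of _ u] exI[of _ "to_complex \<tau>"]) (simp add: to_complex_add)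
qed

text \<open>The Cayley transform: for \<open>u = exp (\<i> \<phi>)\<close> the witness
  \<open>Im u / (1 - Re u)\<close> is \<open>cot (\<phi> / 2)\<close>.\<close>

lemma unit_complex_eq_quotient:
  assumes "norm u = 1" "u \<noteq> 1"
  shows "\<exists>s. u * (of_real s - \<i>) = of_real s + \<i>"
proof -
  have sq: "(Re u)\<^sup>2 + (Im u)\<^sup>2 = 1"
    using assms(1) by (simp add: cmod_def)
  have "Re u \<noteq> 1"
    using sq assms(2) by (auto simp: complex_eq_iff)
  define s where "s = Im u / (1 - Re u)"
  have s: "s * (1 - Re u) = Im u"
    using \<open>Re u \<noteq> 1\<close> by (simp add: s_def)
  have "(Im u * s - Re u - 1) * (1 - Re u) = Im u * (s * (1 - Re u)) - (1 - (Re u)\<^sup>2)"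
    by (simp add: algebra_simps power2_eq_square)
  also have "\<dots> = 0" using s sq by (simp add: power2_eq_square)
  finally have "Im u * s - Re u = 1" using \<open>Re u \<noteq> 1\<close> by simp
  then have "u * (of_real s - \<i>) = of_real s + \<i>"
    using s by (simp add: complex_eq_iff algebra_simps)
  then show ?thesis ..
qed

section \<open>Collinearity through determinants\<close>

text \<open>Twice the signed area of the triangle \<open>a b c\<close>.\<close>

definition cross :: "real^2 \<Rightarrow> real^2 \<Rightarrow> real^2 \<Rightarrow> real"
  where "cross a b c = (b$1 - a$1) * (c$2 - a$2) - (b$2 - a$2) * (c$1 - a$1)"

lemma collinear_cross:
  assumes "collinear S" "a \<in> S" "b \<in> S" "c \<in> S"
  shows "cross a b c = 0"
proof -
  obtain u where u: "\<And>x y. x \<in> S \<Longrightarrow> y \<in> S \<Longrightarrow> \<exists>c. x - y = c *\<^sub>R u"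
    using assms(1) unfolding collinear_def by blast
  obtain s t where st: "b - a = s *\<^sub>R u" "c - a = t *\<^sub>R u" using u assms by meson
  have "b$1 - a$1 = s * u$1" "b$2 - a$2 = s * u$2" "c$1 - a$1 = t * u$1" "c$2 - a$2 = t * u$2"
    using arg_cong[OF st(1), of "\<lambda>v. v $ 1"] arg_cong[OF st(1), of "\<lambda>v. v $ 2"]
      arg_cong[OF st(2), of "\<lambda>v. v $ 1"] arg_cong[OF st(2), of "\<lambda>v. v $ 2"] by simp_all
  then show ?thesis by (simp add: cross_def)
qed

lemma cross_zero_param:
  assumes "cross a b c = 0" "a \<noteq> b"
  shows "\<exists>t. c = a + t *\<^sub>R (b - a)"
proof (cases "b$1 = a$1")
  case True
  then have "b$2 \<noteq> a$2" using assms(2) by (auto simp: vec_eq_iff forall_2)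
  moreover from this have "c$1 = a$1" using assms(1) True by (simp add: cross_def)
  ultimately show ?thesis using True
    by (intro exI[of _ "(c$2 - a$2) / (b$2 - a$2)"]) (simp add: vec_eq_iff forall_2)
next
  case False
  then have "(c$1 - a$1) / (b$1 - a$1) * (b$2 - a$2) = c$2 - a$2"
    using assms(1) by (simp add: cross_def field_simps)
  then show ?thesis using False
    by (intro exI[of _ "(c$1 - a$1) / (b$1 - a$1)"]) (simp add: vec_eq_iff forall_2)
qed

lemma cross_zero_collinear:
  assumes "a \<noteq> b" "\<And>c. c \<in> E \<Longrightarrow> cross a b c = 0"
  shows "collinear E"
  unfolding collinear_alt using assms cross_zero_param by blast

text \<open>Triangles with apex \<open>p\<close> and base on a fixed line have area proportional to
  the base.\<close>

lemma cross_apex_neq_0: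
  assumes "a \<noteq> b" "cross a b c = 0" "cross a b d = 0" "c \<noteq> d" "cross a b p \<noteq> 0"
  shows "cross p c d \<noteq> 0"
proof -
  obtain s t where st: "c = a + s *\<^sub>R (b - a)" "d = a + t *\<^sub>R (b - a)"
    using cross_zero_param assms by metis
  have "cross p c d = (t - s) * cross a b p"
    by (simp add: st cross_def algebra_simps)
  then show ?thesis using assms st by auto
qed

lemma nonsingular_if_cross:
  assumes "cross (x 1) (x 2) (x 3) \<noteq> 0"
  shows "nonsingular x"
proof -
  have ne: "x 1 \<noteq> x 2" "x 1 \<noteq> x 3" "x 2 \<noteq> x 3"
    using assms by (auto simp: cross_def algebra_simps)
  have "\<not> collinear {x 1, x 2, x 3}"
    using collinear_cross assms by blast
  then have "\<not> affine_dependent {x 1, x 2, x 3}"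
    by (simp add: collinear_3_eq_affine_dependent)
  then show ?thesis
    using ne by (auto simp: nonsingular_def inj_on_def)
qed

section \<open>Building and counting tuples\<close>

lemma finite_tuples: "finite E \<Longrightarrow> finite (tuples n E)"
  by (simp add: tuples_def finite_PiE)

lemma card_tuples: "card (tuples n E) = card E ^ n"
  by (simp add: tuples_def card_PiE)

lemma finite_nonsingular_tuples: "finite E \<Longrightarrow> finite (nonsingular_tuples k E)"
  by (rule finite_subset[OF _ finite_tuples[of E "k+1"]]) (auto simp: nonsingular_tuples_def)

lemma nonsingular_tuples_mono: "nonsingular_tuples k E \<subseteq> nonsingular_tuples k UNIV"
  by (auto simp: nonsingular_tuples_def tuples_def PiE_iff)

lemma tuples_eqI:
  assumes "x \<in> tuples n S" "y \<in> tuples n S'" "\<And>j. j \<in> {1..n} \<Longrightarrow> x j = y j"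
  shows "x = y"
  using assms unfolding tuples_def by (intro PiE_ext[of x _ _ y]) (auto simp: PiE_iff)

definition extend_triple :: "'a \<times> 'a \<times> 'a \<Rightarrow> (nat \<Rightarrow> 'a) \<Rightarrow> nat \<Rightarrow> 'a"
  where "extend_triple p h = (\<lambda>(a, b, c) j. if j = 1 then a else if j = 2 then b else if j = 3 then c else h j) p"

lemma extend_triple_simps [simp]:
  "extend_triple (a, b, c) h 1 = a" "extend_triple (a, b, c) h (Suc 0) = a"
  "extend_triple (a, b, c) h 2 = b" "extend_triple (a, b, c) h 3 = c"
  "j \<ge> 4 \<Longrightarrow> extend_triple (a, b, c) h j = h j"
  by (simp_all add: extend_triple_def)

text \<open>The triple decides non-singularity and the tail is free, so such families have an exact
  count. For \<open>k = 2\<close> the tail \<open>{4..k+1}\<close> is empty.\<close>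

definition triple_extensions :: "nat \<Rightarrow> ('a \<times> 'a \<times> 'a) set \<Rightarrow> 'a set \<Rightarrow> (nat \<Rightarrow> 'a) set"
  where "triple_extensions k T B = (\<lambda>(p, h). extend_triple p h) ` (T \<times> ({4..k+1} \<rightarrow>\<^sub>E B))"

lemma card_triple_extensions:
  assumes "k \<ge> 2"
  shows "card (triple_extensions k T B) = card T * card B ^ (k - 2)"
proof -
  have "inj_on (\<lambda>(p, h). extend_triple p h) (T \<times> ({4..k+1} \<rightarrow>\<^sub>E B))"
  proof (rule inj_onI, clarify)
    fix a b c a' b' c' :: 'a and h h'
    assume h: "h \<in> {4..k+1} \<rightarrow>\<^sub>E B" "h' \<in> {4..k+1} \<rightarrow>\<^sub>E B"
      and eq: "extend_triple (a, b, c) h = extend_triple (a', b', c') h'"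
    have "h j = h' j" if "j \<in> {4..k+1}" for j
      using fun_cong[OF eq, of j] that by simp
    then have "h = h'" using h by (intro PiE_ext[of h _ _ h']) auto
    moreover have "a = a'" "b = b'" "c = c'"
      using fun_cong[OF eq, of 1] fun_cong[OF eq, of 2] fun_cong[OF eq, of 3] by simp_all
    ultimately show "(a, b, c) = (a', b', c') \<and> h = h'" by simp
  qed
  moreover have "card {4..k+1} = k - 2" using assms by simp
  ultimately show ?thesis
    unfolding triple_extensions_def by (simp add: card_image card_cartesian_product card_PiE)
qed

lemma triple_extensions_subset:
  assumes "k \<ge> 2" "T \<subseteq> E \<times> E \<times> E" "B \<subseteq> E"
  shows "triple_extensions k T B \<subseteq> tuples (k+1) E"
proof
  fix x assume "x \<in> triple_extensions k T B"
  then obtain a b c h where x: "x = extend_triple (a, b, c) h" "(a, b, c) \<in> T" "h \<in> {4..k+1} \<rightarrow>\<^sub>E B"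
    by (auto simp: triple_extensions_def)
  have "x j \<in> E" if "j \<in> {1..k+1}" for j
    using x that assms by (auto simp: extend_triple_def PiE_iff)
  moreover have "x j = undefined" if "j \<notin> {1..k+1}" for j
    using x that assms by (auto simp: extend_triple_def PiE_iff extensional_def)
  ultimately show "x \<in> tuples (k+1) E"
    by (auto simp: tuples_def PiE_iff extensional_def)
qed

section \<open>Non-singular tuples, with and without a rich line\<close>

lemma card_ordered_pairs: "finite S \<Longrightarrow> card {(c, d). c \<in> S \<and> d \<in> S \<and> c \<noteq> d} = card S * (card S - 1)"
proof -
  assume S: "finite S"
  have "{(c, d). c \<in> S \<and> d \<in> S \<and> c \<noteq> d} = (SIGMA c:S. S - {c})" by auto
  then show ?thesis using S by (simp add: card_SigmaI)
qed

text \<open>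
  The motions considered here fix the apex, so a nontrivial one would move the line, which does not
  pass through the apex.
\<close>

lemma multiplier_eq_1:
  assumes "Im p = d" "Im q = d" "Im (u * p) = d" "Im (u * q) = d" "p \<noteq> q" "d \<noteq> 0"
  shows "u = 1"
proof -
  have "Re p \<noteq> Re q" using assms by (auto simp: complex_eq_iff)
  moreover have "Im u * (Re p - Re q) = 0"
  proof -
    have "Im u * (Re p - Re q) = Im (u * p) - Im (u * q) - Re u * (Im p - Im q)"
      by (simp add: algebra_simps)
    also have "\<dots> = 0" by (simp only: assms(1-4)) simp
    finally show ?thesis .
  qed
  ultimately have "Im u = 0" by simp
  then have "Re u * d = d" using assms by simp
  then show ?thesis using \<open>Im u = 0\<close> \<open>d \<noteq> 0\<close> by (simp add: complex_eq_iff)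
qed

lemma cross_to_complex: "cross a b c = Im (cnj (to_complex b - to_complex a) * (to_complex c - to_complex a))"
  by (simp add: cross_def to_complex_def algebra_simps)

lemma congruent_apex_eq:
  assumes xy: "(x, y) \<in> congruence k" and k: "k \<ge> 2"
    and ab: "a \<noteq> b" and p: "cross a b p \<noteq> 0" "x 1 = p" "y 1 = p"
    and line: "cross a b (x 2) = 0" "cross a b (x 3) = 0" "cross a b (y 2) = 0" "cross a b (y 3) = 0"
    and ne: "x 2 \<noteq> x 3"
  shows "x = y"
proof -
  obtain u w where uw: "\<And>j. j \<in> {1..k+1} \<Longrightarrow> to_complex (y j) = u * to_complex (x j) + w"
    using congruence_to_complex[OF xy] by blast
  \<comment> \<open>Subtracting \<open>P\<close> puts the apex at 0, and multiplying by
    \<open>v\<close> makes the line through \<open>a\<close> and \<open>b\<close> horizontal: it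
    becomes \<open>Im z = - cross a b p\<close>.\<close>
  define v P where "v = cnj (to_complex b - to_complex a)" and "P = to_complex p"
  have "v \<noteq> 0" using ab by (simp add: v_def to_complex_eq_iff)
  have w: "P = u * P + w" using uw[of 1] p by (simp add: P_def)
  have line': "Im (v * (to_complex c - P)) = - cross a b p" if "cross a b c = 0" for c
  proof -
    have "v * (to_complex c - P) = v * (to_complex c - to_complex a) - v * (P - to_complex a)"
      by (simp add: algebra_simps)
    then show ?thesis using that unfolding cross_to_complex v_def P_def by simp
  qed
  have move: "u * (v * (to_complex (x j) - P)) = v * (to_complex (y j) - P)" if "j \<in> {1..k+1}" for j
  proof -
    have "to_complex (y j) - P = u * (to_complex (x j) - P)"
      using uw[OF that] w by (simp add: algebra_simps)
    then show ?thesis by simp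
  qed
  have j: "2 \<in> {1..k+1}" "3 \<in> {1..k+1}" using k by simp_all
  have "u = 1"
  proof (rule multiplier_eq_1)
    show "Im (v * (to_complex (x 2) - P)) = - cross a b p" "Im (v * (to_complex (x 3) - P)) = - cross a b p"
      using line' line by auto
    show "Im (u * (v * (to_complex (x 2) - P))) = - cross a b p"
      "Im (u * (v * (to_complex (x 3) - P))) = - cross a b p"
      unfolding move[OF j(1)] move[OF j(2)] by (rule line'[OF line(3)], rule line'[OF line(4)])
    show "v * (to_complex (x 2) - P) \<noteq> v * (to_complex (x 3) - P)"
      using \<open>v \<noteq> 0\<close> ne by (simp add: to_complex_eq_iff)
  qed (use p in simp)
  then have "x j = y j" if "j \<in> {1..k+1}" for j
    using uw[OF that] w by (simp add: to_complex_eq_iff)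
  moreover have "x \<in> tuples (k+1) UNIV" "y \<in> tuples (k+1) UNIV"
    using xy by (auto simp: congruence_def nonsingular_tuples_def)
  ultimately show ?thesis using tuples_eqI by blast
qed

lemma M2_eq_image: "M2 k E = (\<lambda>x. congruence k `` {x}) ` nonsingular_tuples k E"
  by (auto simp: M2_def quotient_def)

lemma class_eq_iff:
  assumes "x \<in> nonsingular_tuples k E" "y \<in> nonsingular_tuples k E"
  shows "congruence k `` {x} = congruence k `` {y} \<longleftrightarrow> (x, y) \<in> congruence k"
  using eq_equiv_class_iff[OF equiv_congruence] assms nonsingular_tuples_mono by blast

text \<open>A factor \<open>2 ^ k\<close> is lost because the line is only known to hold half of
  \<open>E\<close>, and one more 2 because distinct second and third entries leave
  \<open>m * (m - 1)\<close> choices, with \<open>m \<le> 2 * (m - 1)\<close>.\<close>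

lemma card_M2_rich_line:
  assumes k: "k \<ge> 2" and E: "finite E" "\<not> collinear E" "card E \<ge> 4"
    and ab: "a \<noteq> b" and rich: "card E \<le> 2 * card {c \<in> E. cross a b c = 0}"
  shows "card E ^ k \<le> 2 ^ (k + 1) * card (M2 k E)"
proof -
  define S where "S = {c \<in> E. cross a b c = 0}"
  define m where "m = card S"
  have m: "m \<ge> 2" "card E \<le> 2 * m" using E rich by (auto simp: m_def S_def)
  have finS: "finite S" and SE: "S \<subseteq> E" using E by (auto simp: S_def)
  obtain p where p: "p \<in> E" "cross a b p \<noteq> 0"
    using cross_zero_collinear[OF ab] E by blast
  define T where "T = (\<lambda>(c, d). (p, c, d)) ` {(c, d). c \<in> S \<and> d \<in> S \<and> c \<noteq> d}"
  have T: "card T = m * (m - 1)"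
    unfolding T_def m_def by (subst card_image) (auto simp: inj_on_def card_ordered_pairs[OF finS])
  define Y where "Y = triple_extensions k T S"
  have props: "x 1 = p \<and> x 2 \<in> S \<and> x 3 \<in> S \<and> x 2 \<noteq> x 3" if "x \<in> Y" for x
    using that by (auto simp: Y_def triple_extensions_def T_def)
  have "Y \<subseteq> tuples (k+1) E"
    unfolding Y_def by (rule triple_extensions_subset[OF k]) (use SE p in \<open>auto simp: T_def\<close>)
  moreover have "nonsingular x" if "x \<in> Y" for x
    using nonsingular_if_cross[of x] cross_apex_neq_0[OF ab, of "x 2" "x 3" p] props[OF that] p
    by (auto simp: S_def)
  ultimately have Y: "Y \<subseteq> nonsingular_tuples k E"
    by (auto simp: nonsingular_tuples_def)
  have "inj_on (\<lambda>x. congruence k `` {x}) Y"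
  proof (rule inj_onI)
    fix x y assume xy: "x \<in> Y" "y \<in> Y" "congruence k `` {x} = congruence k `` {y}"
    then have "(x, y) \<in> congruence k" using class_eq_iff Y by blast
    then show "x = y"
      using congruent_apex_eq[OF _ k ab p(2)] props[OF xy(1)] props[OF xy(2)] by (auto simp: S_def)
  qed
  then have "card Y = card ((\<lambda>x. congruence k `` {x}) ` Y)"
    by (rule card_image[symmetric])
  also have "\<dots> \<le> card (M2 k E)"
    unfolding M2_eq_image using Y finite_nonsingular_tuples[OF E(1)] by (intro card_mono image_mono) auto
  finally have "m * (m - 1) * m ^ (k - 2) \<le> card (M2 k E)"
    unfolding Y_def card_triple_extensions[OF k] T m_def .
  then have M: "2 ^ (k + 1) * (m * (m - 1) * m ^ (k - 2)) \<le> 2 ^ (k + 1) * card (M2 k E)"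
    by simp
  have "card E ^ k \<le> (2 * m) ^ k" using m by (intro power_mono) auto
  also have "\<dots> = 2 ^ k * (m * m * m ^ (k - 2))"
    using k by (metis power_mult_distrib power2_eq_square power_add le_add_diff_inverse)
  also have "\<dots> \<le> 2 ^ k * (m * (2 * (m - 1)) * m ^ (k - 2))"
    using m by (intro mult_left_mono mult_right_mono) auto
  also have "\<dots> = 2 ^ (k + 1) * (m * (m - 1) * m ^ (k - 2))" by simp
  finally show ?thesis using M by linarith
qed

text \<open>For each ordered pair of distinct points at least half of \<open>E\<close> is off their
  line; together with \<open>n \<le> 2 * (n - 1)\<close> this costs a factor 4.\<close>

lemma card_nonsingular_tuples_ge:
  assumes k: "k \<ge> 2" and E: "finite E" "card E \<ge> 2"
    and poor: "\<And>a b. a \<in> E \<Longrightarrow> b \<in> E \<Longrightarrow> a \<noteq> b \<Longrightarrow> 2 * card {c \<in> E. cross a b c = 0} \<le> card E"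
  shows "card E ^ (k + 1) \<le> 4 * card (nonsingular_tuples k E)"
proof -
  let ?n = "card E"
  define T where "T = {(a, b, c). a \<in> E \<and> b \<in> E \<and> c \<in> E \<and> cross a b c \<noteq> 0}"
  have "T \<subseteq> E \<times> E \<times> E" by (auto simp: T_def)
  define U where "U = (SIGMA p:{(a, b). a \<in> E \<and> b \<in> E \<and> a \<noteq> b}. {c \<in> E. cross (fst p) (snd p) c \<noteq> 0})"
  have finD: "finite {(a, b). a \<in> E \<and> b \<in> E \<and> a \<noteq> b}"
    by (rule finite_subset[of _ "E \<times> E"]) (use E in auto)
  have "?n * (?n - 1) * ?n = (\<Sum>p\<in>{(a, b). a \<in> E \<and> b \<in> E \<and> a \<noteq> b}. ?n)"
    using card_ordered_pairs[OF E(1)] by simp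
  also have "\<dots> \<le> (\<Sum>p\<in>{(a, b). a \<in> E \<and> b \<in> E \<and> a \<noteq> b}. 2 * card {c \<in> E. cross (fst p) (snd p) c \<noteq> 0})"
  proof (rule sum_mono, clarify)
    fix a b assume ab: "a \<in> E" "b \<in> E" "a \<noteq> b"
    have "{c \<in> E. cross a b c \<noteq> 0} = E - {c \<in> E. cross a b c = 0}" by auto
    then have "card {c \<in> E. cross a b c \<noteq> 0} = ?n - card {c \<in> E. cross a b c = 0}"
      using E by (simp add: card_Diff_subset)
    then show "?n \<le> 2 * card {c \<in> E. cross (fst (a, b)) (snd (a, b)) c \<noteq> 0}"
      using poor[OF ab] by simp
  qed
  also have "\<dots> = 2 * card U"
    unfolding U_def using finD E by (subst card_SigmaI) (auto simp: sum_distrib_left)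
  also have "card U \<le> card T"
  proof (rule card_inj_on_le)
    show "inj_on (\<lambda>(p, c). (fst p, snd p, c)) U" by (auto simp: inj_on_def)
    show "(\<lambda>(p, c). (fst p, snd p, c)) ` U \<subseteq> T" by (auto simp: U_def T_def)
    show "finite T" by (rule finite_subset[OF \<open>T \<subseteq> E \<times> E \<times> E\<close>]) (use E in simp)
  qed
  finally have "2 * (?n - 1) * ?n ^ 2 \<le> 4 * card T"
    by (simp add: power2_eq_square mult_ac)
  moreover have "?n * ?n ^ 2 \<le> 2 * (?n - 1) * ?n ^ 2"
    using E by (intro mult_right_mono) auto
  ultimately have "?n * ?n ^ 2 \<le> 4 * card T"
    by (rule order_trans[rotated])
  then have "?n ^ 3 \<le> 4 * card T"
    by (simp add: power2_eq_square power3_eq_cube)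
  then have "?n ^ 3 * ?n ^ (k - 2) \<le> 4 * card T * ?n ^ (k - 2)"
    by (rule mult_right_mono) simp
  moreover have "?n ^ 3 * ?n ^ (k - 2) = ?n ^ (k + 1)"
    using k by (simp add: power_add[symmetric])
  moreover have "triple_extensions k T E \<subseteq> nonsingular_tuples k E"
    using triple_extensions_subset[OF k \<open>T \<subseteq> E \<times> E \<times> E\<close>, of E]
    by (auto simp: nonsingular_tuples_def triple_extensions_def T_def intro!: nonsingular_if_cross)
  then have "card T * ?n ^ (k - 2) \<le> card (nonsingular_tuples k E)"
    unfolding card_triple_extensions[OF k, symmetric]
    by (rule card_mono[OF finite_nonsingular_tuples[OF E(1)]])
  ultimately show ?thesis by linarith
qed

section \<open>Counting congruent pairs\<close>

text \<open>Cauchy-Schwarz for the fibre sizes of \<open>f\<close>, whose squares add up to the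
  number of pairs. It is applied to the map from tuples to classes.\<close>

lemma card_squared_le_image_times_pairs:
  assumes "finite A"
  shows "card A ^ 2 \<le> card (f ` A) * card {(x, y). x \<in> A \<and> y \<in> A \<and> f x = f y}"
proof -
  let ?c = "\<lambda>v. card {x \<in> A. f x = v}"
  have 1: "card A = (\<Sum>v\<in>f ` A. ?c v)"
    using sum.group[OF assms finite_imageI[OF assms], of f f "\<lambda>_. 1 :: nat"] by simp
  have "{(x, y). x \<in> A \<and> y \<in> A \<and> f x = f y} = (\<Union>v\<in>f ` A. {x \<in> A. f x = v} \<times> {x \<in> A. f x = v})"
    by auto
  also have "card \<dots> = (\<Sum>v\<in>f ` A. card ({x \<in> A. f x = v} \<times> {x \<in> A. f x = v}))"
    using assms by (intro card_UN_disjoint) auto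
  also have "\<dots> = (\<Sum>v\<in>f ` A. ?c v ^ 2)"
    by (simp add: card_cartesian_product power2_eq_square)
  finally have 2: "card {(x, y). x \<in> A \<and> y \<in> A \<and> f x = f y} = (\<Sum>v\<in>f ` A. ?c v ^ 2)" .
  have "(\<Sum>v\<in>f ` A. real (?c v))\<^sup>2 \<le> (\<Sum>v\<in>f ` A. (real (?c v))\<^sup>2) * real (card (f ` A))"
    by (rule sum_squared_le_sum_of_squares)
  then have "real ((\<Sum>v\<in>f ` A. ?c v) ^ 2) \<le> real ((\<Sum>v\<in>f ` A. ?c v ^ 2) * card (f ` A))"
    by simp
  then have "(\<Sum>v\<in>f ` A. ?c v) ^ 2 \<le> (\<Sum>v\<in>f ` A. ?c v ^ 2) * card (f ` A)"
    by (rule of_nat_le_iff[THEN iffD1])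
  then show ?thesis unfolding 1[symmetric] 2 by (simp add: mult.commute)
qed

definition congruent_pairs :: "nat \<Rightarrow> (real^2) set \<Rightarrow> ((nat \<Rightarrow> real^2) \<times> (nat \<Rightarrow> real^2)) set"
  where "congruent_pairs k E = {(x, y). x \<in> nonsingular_tuples k E \<and> y \<in> nonsingular_tuples k E \<and> (x, y) \<in> congruence k}"

text \<open>Either the rotation factor is 1, or the motion has coordinates and matches every entry.
  As \<open>x 1\<close> and \<open>x 2\<close> differ, its richness is then at least 2.\<close>

lemma congruent_pairs_cases:
  assumes "(x, y) \<in> congruent_pairs k E" and k: "k \<ge> 2" and E: "finite E"
  shows "(\<exists>w. \<forall>j\<in>{1..k+1}. to_complex (y j) = to_complex (x j) + w) \<or>
    (\<exists>g\<in>rich_motions (to_complex ` E) 2. \<forall>j\<in>{1..k+1}. (to_complex (x j), to_complex (y j)) \<in> matched (to_complex ` E) g)"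
proof -
  have xy: "x \<in> nonsingular_tuples k E" "y \<in> nonsingular_tuples k E" "(x, y) \<in> congruence k"
    using assms by (auto simp: congruent_pairs_def)
  obtain u w where u: "norm u = 1" and uw: "\<And>j. j \<in> {1..k+1} \<Longrightarrow> to_complex (y j) = u * to_complex (x j) + w"
    using congruence_to_complex[OF xy(3)] by blast
  show ?thesis
  proof (cases "u = 1")
    case True
    then show ?thesis using uw by (intro disjI1 exI[of _ w]) simp
  next
    case False
    then obtain s where s: "u * (of_real s - \<i>) = of_real s + \<i>"
      using unit_complex_eq_quotient u by blast
    \<comment> \<open>Multiplying \<open>y = u * x + w\<close> by \<open>s - \<i>\<close> clears the
      denominator of \<open>u\<close>.\<close>
    define g where "g = (s, w * (of_real s - \<i>))"
    have m: "(to_complex (x j), to_complex (y j)) \<in> matched (to_complex ` E) g" if j: "j \<in> {1..k+1}" for j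
    proof -
      have "to_complex (y j) * (of_real s - \<i>) = to_complex (x j) * (u * (of_real s - \<i>)) + w * (of_real s - \<i>)"
        unfolding uw[OF j] by (simp add: algebra_simps)
      moreover have "x j \<in> E" "y j \<in> E"
        using xy j by (auto simp: nonsingular_tuples_def tuples_def PiE_iff)
      ultimately show ?thesis unfolding s by (simp add: matched_def g_def)
    qed
    have "x 1 \<noteq> x 2"
      using xy(1) by (auto simp: nonsingular_tuples_def nonsingular_def inj_on_def)
    then have "card {(to_complex (x 1), to_complex (y 1)), (to_complex (x 2), to_complex (y 2))} = 2"
      by (simp add: to_complex_eq_iff)
    moreover have "card {(to_complex (x 1), to_complex (y 1)), (to_complex (x 2), to_complex (y 2))} \<le>
        card (matched (to_complex ` E) g)"
      using m[of 1] m[of 2] k E by (intro card_mono finite_matched) auto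
    ultimately have "g \<in> rich_motions (to_complex ` E) 2" by (simp add: rich_motions_def)
    then show ?thesis using m by blast
  qed
qed

text \<open>\<open>x\<close> and the single entry \<open>y 1\<close> fix the translation, hence all
  of \<open>y\<close>.\<close>

lemma card_translate_pairs_le:
  assumes E: "finite E"
  shows "card {(x, y). x \<in> tuples (k+1) E \<and> y \<in> tuples (k+1) E \<and>
    (\<exists>w. \<forall>j\<in>{1..k+1}. to_complex (y j) = to_complex (x j) + w)} \<le> card E ^ (k + 2)" (is "card ?Q \<le> _")
proof -
  have "card ?Q \<le> card (tuples (k+1) E \<times> E)"
  proof (rule card_inj_on_le)
    show "inj_on (\<lambda>(x, y). (x, y 1)) ?Q"
    proof (rule inj_onI, clarify)
      fix x y y' w w'
      assume y: "y \<in> tuples (k+1) E" "y' \<in> tuples (k+1) E" and "y 1 = y' 1"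
        and w: "\<forall>j\<in>{1..k+1}. to_complex (y j) = to_complex (x j) + w"
          "\<forall>j\<in>{1..k+1}. to_complex (y' j) = to_complex (x j) + w'"
      then have "w = w'" using w[THEN bspec, of 1] by simp
      then have "y j = y' j" if "j \<in> {1..k+1}" for j
        using w that by (metis to_complex_eq_iff)
      then show "x = x \<and> y = y'" using tuples_eqI[OF y] by simp
    qed
    have "y 1 \<in> E" if "y \<in> tuples (k+1) E" for y
      using that by (simp add: tuples_def PiE_iff)
    then show "(\<lambda>(x, y). (x, y 1)) ` ?Q \<subseteq> tuples (k+1) E \<times> E"
      by (intro image_subsetI) (simp add: case_prod_beta mem_Times_iff)
    show "finite (tuples (k+1) E \<times> E)" using E finite_tuples by blast
  qed
  then show ?thesis by (simp add: card_cartesian_product card_tuples mult.commute)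
qed

lemma card_matched_tuples_le:
  assumes A: "finite A"
  shows "card {(x, y). x \<in> tuples n E \<and> y \<in> tuples n E \<and>
    (\<forall>j\<in>{1..n}. (to_complex (x j), to_complex (y j)) \<in> matched A g)} \<le> card (matched A g) ^ n"
    (is "card ?Q \<le> _")
proof -
  let ?f = "\<lambda>(x, y). \<lambda>j\<in>{1..n}. (to_complex (x j), to_complex (y j))"
  have "card ?Q \<le> card ({1..n} \<rightarrow>\<^sub>E matched A g)"
  proof (rule card_inj_on_le)
    show "inj_on ?f ?Q"
    proof (rule inj_onI, clarify)
      fix x y x' y'
      assume t: "x \<in> tuples n E" "y \<in> tuples n E" "x' \<in> tuples n E" "y' \<in> tuples n E"
        and eq: "(\<lambda>j\<in>{1..n}. (to_complex (x j), to_complex (y j))) = (\<lambda>j\<in>{1..n}. (to_complex (x' j), to_complex (y' j)))"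
      have "x j = x' j \<and> y j = y' j" if "j \<in> {1..n}" for j
        using fun_cong[OF eq, of j] that by (simp add: to_complex_eq_iff)
      then show "x = x' \<and> y = y'" using tuples_eqI t by meson
    qed
    show "?f ` ?Q \<subseteq> {1..n} \<rightarrow>\<^sub>E matched A g" by auto
    show "finite ({1..n} \<rightarrow>\<^sub>E matched A g)" using finite_matched[OF A] by (simp add: finite_PiE)
  qed
  then show ?thesis by (simp add: card_PiE)
qed

text \<open>Only the third moment of the richness is needed, as \<open>k - 2\<close> of the
  \<open>k + 1\<close> factors are bounded by \<open>card E\<close>. The summand 1 accounts for
  translations.\<close>

lemma card_congruent_pairs_le:
  assumes k: "k \<ge> 2" and E: "finite E"
  shows "real (card (congruent_pairs k E)) \<le>
    real (card E) ^ (k + 2) * (1 + 870 * (\<Sum>t=1..card E. 1 / real t))"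
proof -
  let ?A = "to_complex ` E" and ?n = "card E"
  let ?G = "rich_motions ?A 2"
  let ?r = "\<lambda>g. card (matched ?A g)"
  let ?T = "{(x, y). x \<in> tuples (k+1) E \<and> y \<in> tuples (k+1) E \<and>
    (\<exists>w. \<forall>j\<in>{1..k+1}. to_complex (y j) = to_complex (x j) + w)}"
  let ?R = "\<lambda>g. {(x, y). x \<in> tuples (k+1) E \<and> y \<in> tuples (k+1) E \<and>
    (\<forall>j\<in>{1..k+1}. (to_complex (x j), to_complex (y j)) \<in> matched ?A g)}"
  have A: "finite ?A" and n: "card ?A = ?n"
    using E by (auto intro!: card_image inj_on_subset[OF inj_to_complex])
  have finG: "finite ?G" using rich_motions_2[OF A] by blast
  have fin: "finite ?T" "finite (?R g)" for g
    by (rule finite_subset[of _ "tuples (k+1) E \<times> tuples (k+1) E"]; use finite_tuples[OF E] in auto)+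
  have "congruent_pairs k E \<subseteq> ?T \<union> (\<Union>g\<in>?G. ?R g)"
  proof
    fix p assume p: "p \<in> congruent_pairs k E"
    obtain x y where [simp]: "p = (x, y)" by (metis surj_pair)
    have "x \<in> tuples (k+1) E" "y \<in> tuples (k+1) E"
      using p by (auto simp: congruent_pairs_def nonsingular_tuples_def)
    then show "p \<in> ?T \<union> (\<Union>g\<in>?G. ?R g)"
      using congruent_pairs_cases[of x y k E] p k E by auto
  qed
  then have "card (congruent_pairs k E) \<le> card (?T \<union> (\<Union>g\<in>?G. ?R g))"
    by (rule card_mono[rotated]) (use fin finG in blast)
  also have "\<dots> \<le> card ?T + card (\<Union>g\<in>?G. ?R g)" by (rule card_Un_le)
  also have "\<dots> \<le> ?n ^ (k + 2) + (\<Sum>g\<in>?G. card (?R g))"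
    by (intro add_mono card_translate_pairs_le E card_UN_le finG)
  also have "\<dots> \<le> ?n ^ (k + 2) + (\<Sum>g\<in>?G. ?n ^ (k - 2) * ?r g ^ 3)"
  proof (intro add_left_mono sum_mono)
    fix g
    have "card (?R g) \<le> ?r g ^ (k + 1)" by (rule card_matched_tuples_le[OF A])
    also have "\<dots> = ?r g ^ (k - 2) * ?r g ^ 3"
      using k by (simp add: power_add[symmetric])
    also have "\<dots> \<le> ?n ^ (k - 2) * ?r g ^ 3"
      using card_matched_le[OF A, of g] n by (intro mult_right_mono power_mono) auto
    finally show "card (?R g) \<le> ?n ^ (k - 2) * ?r g ^ 3" .
  qed
  also have "\<dots> = ?n ^ (k + 2) + ?n ^ (k - 2) * (\<Sum>g\<in>?G. ?r g ^ 3)"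
    by (simp add: sum_distrib_left)
  finally have "real (card (congruent_pairs k E)) \<le> real (?n ^ (k + 2) + ?n ^ (k - 2) * (\<Sum>g\<in>?G. ?r g ^ 3))"
    by (rule of_nat_mono)
  also have "\<dots> = real ?n ^ (k + 2) + real ?n ^ (k - 2) * real (\<Sum>g\<in>?G. ?r g ^ 3)"
    by simp
  also have "\<dots> \<le> real ?n ^ (k + 2) + real ?n ^ (k - 2) * (870 * real ?n ^ 4 * (\<Sum>t=1..?n. 1 / real t))"
    using sum_matched_cubes_le[OF A] unfolding n by (intro add_left_mono mult_left_mono) auto
  also have "\<dots> = real ?n ^ (k + 2) + 870 * (real ?n ^ (k - 2) * real ?n ^ 4) * (\<Sum>t=1..?n. 1 / real t)"
    by simp
  also have "real ?n ^ (k - 2) * real ?n ^ 4 = real ?n ^ (k + 2)"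
    using k by (simp add: power_add[symmetric])
  finally show ?thesis by (simp add: algebra_simps)
qed

text \<open>Squaring the lower bound \<open>card E ^ (k + 1) / 4\<close> for non-singular tuples
  gives the 16, and dividing \<open>card E ^ (2 * k + 2)\<close> by the
  \<open>card E ^ (k + 2)\<close> of the pair count leaves exponent \<open>k\<close>.\<close>

lemma card_M2_poor_lines:
  assumes k: "k \<ge> 2" and E: "finite E" "card E \<ge> 2"
    and poor: "\<And>a b. a \<in> E \<Longrightarrow> b \<in> E \<Longrightarrow> a \<noteq> b \<Longrightarrow> 2 * card {c \<in> E. cross a b c = 0} \<le> card E"
  shows "real (card E) ^ k \<le> 16 * (1 + 870 * (\<Sum>t=1..card E. 1 / real t)) * real (card (M2 k E))"
proof -
  let ?n = "real (card E)" and ?N = "nonsingular_tuples k E"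
  define H where "H = 1 + 870 * (\<Sum>t=1..card E. 1 / real t)"
  have "{(x, y). x \<in> ?N \<and> y \<in> ?N \<and> congruence k `` {x} = congruence k `` {y}} = congruent_pairs k E"
    using class_eq_iff unfolding congruent_pairs_def by blast
  then have "card ?N ^ 2 \<le> card (M2 k E) * card (congruent_pairs k E)"
    using card_squared_le_image_times_pairs[OF finite_nonsingular_tuples[OF E(1), of k], of "\<lambda>x. congruence k `` {x}"]
    unfolding M2_eq_image by simp
  then have "real (card ?N ^ 2) \<le> real (card (M2 k E) * card (congruent_pairs k E))"
    by (rule of_nat_mono)
  also have "\<dots> = real (card (M2 k E)) * real (card (congruent_pairs k E))" by simp
  also have "\<dots> \<le> real (card (M2 k E)) * (?n ^ (k + 2) * H)"
    unfolding H_def by (intro mult_left_mono card_congruent_pairs_le k E) simp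
  finally have N: "real (card ?N) ^ 2 \<le> real (card (M2 k E)) * (?n ^ (k + 2) * H)" by simp
  have "real (card E ^ (k + 1)) \<le> real (4 * card ?N)"
    by (rule of_nat_mono) (rule card_nonsingular_tuples_ge[OF k E poor])
  then have "(?n ^ (k + 1)) ^ 2 \<le> (4 * real (card ?N)) ^ 2"
    by (intro power_mono) auto
  then have "(?n ^ (k + 1)) ^ 2 \<le> 16 * real (card (M2 k E)) * (?n ^ (k + 2) * H)"
    using N by (simp add: power_mult_distrib)
  moreover have "(?n ^ (k + 1)) ^ 2 = ?n ^ (k + 2) * ?n ^ k"
    unfolding power_mult[symmetric] power_add[symmetric] by (simp add: mult_2_right)
  ultimately have "?n ^ (k + 2) * ?n ^ k \<le> ?n ^ (k + 2) * (16 * H * real (card (M2 k E)))"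
    by (simp add: mult_ac)
  moreover have "?n ^ (k + 2) > 0" using E by (intro zero_less_power) linarith
  ultimately show ?thesis unfolding H_def by (simp only: mult_le_cancel_left_pos)
qed

lemma card_M2_lower_bound:
  fixes \<epsilon> :: real
  assumes k: "k \<ge> 2" and \<epsilon>: "\<epsilon> > 0"
  shows "\<exists>C>0. \<forall>E. finite E \<and> card E > k + 1 \<and> \<not> collinear E \<longrightarrow>
    real (card E) ^ k \<le> C * real (card E) powr \<epsilon> * real (card (M2 k E))"
proof -
  obtain Z where Z: "Z \<ge> 0" "\<And>n. (\<Sum>t=1..n. 1 / real t) \<le> Z * real n powr \<epsilon>"
    using harmonic_le_powr[OF \<epsilon>] by blast
  \<comment> \<open>A sum, so that it dominates the constants of both cases.\<close>
  define C where "C = 2 ^ (k + 1) + 16 * (1 + 870 * Z)"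
  have "real (card E) ^ k \<le> C * real (card E) powr \<epsilon> * real (card (M2 k E))"
    if E: "finite E" "card E > k + 1" "\<not> collinear E" for E
  proof -
    let ?n = "real (card E)" and ?M = "real (card (M2 k E))"
    have n: "card E \<ge> 4" using E k by linarith
    then have pow: "?n powr \<epsilon> \<ge> 1" using \<epsilon> by (intro ge_one_powr_ge_zero) auto
    show ?thesis
    proof (cases "\<exists>a b. a \<noteq> b \<and> card E \<le> 2 * card {c \<in> E. cross a b c = 0}")
      case True
      then obtain a b where "a \<noteq> b" "card E \<le> 2 * card {c \<in> E. cross a b c = 0}" by blast
      then have "card E ^ k \<le> 2 ^ (k + 1) * card (M2 k E)"
        using card_M2_rich_line[OF k E(1,3) n] by blast
      then have "real (card E ^ k) \<le> real (2 ^ (k + 1) * card (M2 k E))" by (rule of_nat_mono)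
      then have "?n ^ k \<le> 2 ^ (k + 1) * 1 * ?M" by simp
      also have "\<dots> \<le> C * ?n powr \<epsilon> * ?M"
        using Z pow by (intro mult_right_mono mult_mono) (auto simp: C_def)
      finally show ?thesis .
    next
      case False
      have "?n ^ k \<le> 16 * (1 + 870 * (\<Sum>t=1..card E. 1 / real t)) * ?M"
        by (rule card_M2_poor_lines[OF k E(1)]) (use n False in force)+
      also have "\<dots> \<le> 16 * (?n powr \<epsilon> + 870 * (Z * ?n powr \<epsilon>)) * ?M"
        by (intro mult_right_mono mult_left_mono add_mono pow Z) auto
      also have "\<dots> = (16 * (1 + 870 * Z)) * ?n powr \<epsilon> * ?M" by (simp add: algebra_simps)
      also have "\<dots> \<le> C * ?n powr \<epsilon> * ?M"
        by (intro mult_right_mono) (auto simp: C_def)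
      finally show ?thesis .
    qed
  qed
  moreover have "C > 0" using Z by (simp add: C_def add_pos_nonneg)
  ultimately show ?thesis by blast
qed

section \<open>Sharpness of the exponent\<close>

lemma congruence_translate:
  assumes "x \<in> nonsingular_tuples k UNIV" "y \<in> nonsingular_tuples k UNIV"
    and "\<And>j. j \<in> {1..k+1} \<Longrightarrow> y j = x j + \<tau>"
  shows "(x, y) \<in> congruence k"
proof -
  have "rotation_matrix (mat 1 :: real^2^2)"
    by (simp add: rotation_matrix_def orthogonal_matrix_id)
  then show ?thesis
    unfolding congruence_def using assms by (auto intro!: exI[of _ "mat 1"] exI[of _ \<tau>])
qed

text \<open>Translates are congruent, so a class depends only on the \<open>k\<close> differences
  from the first entry. Ignoring rotations merely overcounts.\<close>

lemma card_M2_le_differences: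
  assumes E: "finite E"
  shows "card (M2 k E) \<le> card ((\<lambda>(a, b). a - b) ` (E \<times> E)) ^ k"
proof -
  let ?N = "nonsingular_tuples k E" and ?D = "(\<lambda>(a, b). a - b) ` (E \<times> E)"
  let ?c = "\<lambda>x. congruence k `` {x}"
  define d where "d x = (\<lambda>j\<in>{2..k+1}. x j - x 1)" for x :: "nat \<Rightarrow> real^2"
  have d: "?c x = ?c y" if xy: "x \<in> ?N" "y \<in> ?N" "d x = d y" for x y
  proof -
    have "y j = x j + (y 1 - x 1)" if "j \<in> {1..k+1}" for j
      using fun_cong[OF xy(3), of j] that by (cases "j = 1") (auto simp: d_def algebra_simps)
    then have "(x, y) \<in> congruence k"
      using congruence_translate xy nonsingular_tuples_mono by blast
    then show ?thesis using class_eq_iff xy by blast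
  qed
  have "M2 k E \<subseteq> (\<lambda>v. ?c (inv_into ?N d v)) ` d ` ?N"
  proof
    fix v assume "v \<in> M2 k E"
    then obtain x where x: "x \<in> ?N" "v = ?c x" by (auto simp: M2_eq_image)
    have dx: "d x \<in> d ` ?N" using x by simp
    have "?c (inv_into ?N d (d x)) = ?c x"
      using d[OF inv_into_into[OF dx] x(1) f_inv_into_f[OF dx]] .
    then show "v \<in> (\<lambda>v. ?c (inv_into ?N d v)) ` d ` ?N" using x by force
  qed
  then have "card (M2 k E) \<le> card (d ` ?N)"
    using finite_nonsingular_tuples[OF E] by (intro surj_card_le) auto
  also have "d ` ?N \<subseteq> {2..k+1} \<rightarrow>\<^sub>E ?D"
    by (force simp: d_def nonsingular_tuples_def tuples_def PiE_iff)
  then have "card (d ` ?N) \<le> card ({2..k+1} \<rightarrow>\<^sub>E ?D)"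
    using E by (intro card_mono finite_PiE) auto
  finally show ?thesis by (simp add: card_PiE)
qed

text \<open>Running up to \<open>Suc N\<close> puts two points on the line even for
  \<open>N = 0\<close>, so the extra point always makes the set non-collinear.\<close>

definition line_and_point :: "nat \<Rightarrow> (real^2) set"
  where "line_and_point N = insert (vector [0, 1]) ((\<lambda>i. vector [real i, 0]) ` {..Suc N})"

lemma card_line_and_point: "finite (line_and_point N)" "card (line_and_point N) = N + 3"
proof -
  have *: "vector [0, 1] \<notin> (\<lambda>i. vector [real i, 0] :: real^2) ` {..Suc N}"
    by (auto simp: vec_eq_iff forall_2)
  have "card ((\<lambda>i. vector [real i, 0] :: real^2) ` {..Suc N}) = card {..Suc N}"
    by (rule card_image) (auto simp: inj_on_def vec_eq_iff forall_2)
  then show "finite (line_and_point N)" "card (line_and_point N) = N + 3"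
    using * by (auto simp: line_and_point_def)
qed

lemma not_collinear_line_and_point: "\<not> collinear (line_and_point N)"
proof
  assume col: "collinear (line_and_point N)"
  have "vector [real i, 0] \<in> line_and_point N" if "i \<le> 1" for i
    unfolding line_and_point_def by (rule insertI2, rule imageI) (use that in simp)
  from this[of 0] this[of 1]
  have "vector [real 0, 0] \<in> line_and_point N" "vector [real 1, 0] \<in> line_and_point N"
    by simp_all
  moreover have "vector [0, 1] \<in> line_and_point N"
    by (simp add: line_and_point_def)
  ultimately show False
    using collinear_cross[OF col] by (fastforce simp: cross_def)
qed

text \<open>The differences lie in a grid of \<open>2 * N + 3\<close> columns and 3 rows, and
  \<open>3 * (2 * N + 3) \<le> 6 * (N + 3)\<close>.\<close>

lemma card_differences_line_and_point:
  "card ((\<lambda>(a, b). a - b) ` (line_and_point N \<times> line_and_point N)) \<le> 6 * card (line_and_point N)"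
proof -
  let ?I = "{- int (Suc N)..int (Suc N)} \<times> {-1..1::int}"
  let ?f = "\<lambda>(i, e). vector [real_of_int i, real_of_int e] :: real^2"
  have pt: "\<exists>i e. a = ?f (int i, int e) \<and> i \<le> Suc N \<and> e \<le> 1" if a: "a \<in> line_and_point N" for a
  proof (cases "a = vector [0, 1]")
    case True
    then show ?thesis by (intro exI[of _ 0] exI[of _ 1]) simp
  next
    case False
    then obtain i where "i \<le> Suc N" "a = vector [real i, 0]" using a by (auto simp: line_and_point_def)
    then show ?thesis by (intro exI[of _ i] exI[of _ 0]) simp
  qed
  have "(\<lambda>(a, b). a - b) ` (line_and_point N \<times> line_and_point N) \<subseteq> ?f ` ?I"
  proof clarify
    fix a b assume "a \<in> line_and_point N" "b \<in> line_and_point N"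
    then obtain i e i' e' where *: "a = ?f (int i, int e)" "i \<le> Suc N" "e \<le> 1"
        "b = ?f (int i', int e')" "i' \<le> Suc N" "e' \<le> 1"
      using pt by meson
    then have "a - b = ?f (int i - int i', int e - int e')"
      by (simp add: vec_eq_iff forall_2)
    moreover have "(int i - int i', int e - int e') \<in> ?I" using * by auto
    ultimately show "a - b \<in> ?f ` ?I" by blast
  qed
  then have "card ((\<lambda>(a, b). a - b) ` (line_and_point N \<times> line_and_point N)) \<le> card (?f ` ?I)"
    by (rule card_mono[rotated]) simp
  also have "\<dots> \<le> card ?I" by (rule card_image_le) simp
  also have "\<dots> \<le> 6 * card (line_and_point N)"
    by (simp add: card_cartesian_product card_line_and_point)
  finally show ?thesis .
qed

lemma card_M2_line_and_point:
  "real (card (M2 k (line_and_point N))) \<le> 6 ^ k * real (card (line_and_point N)) ^ k"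
proof -
  have "card (M2 k (line_and_point N)) \<le> (6 * card (line_and_point N)) ^ k"
    using card_M2_le_differences[OF card_line_and_point(1)] card_differences_line_and_point
    by (meson order_trans power_mono zero_le)
  then have "real (card (M2 k (line_and_point N))) \<le> real ((6 * card (line_and_point N)) ^ k)"
    by (rule of_nat_mono)
  then show ?thesis by (simp add: power_mult_distrib)
qed

text \<open>Non-collinearity is required in both halves: a collinear set has no classes by
  \<open>M2_collinear_empty\<close>, which would refute the lower bound and make the upper bound
  trivial.\<close>

theorem theorem1p1:
  fixes k :: nat
  assumes "k \<ge> 2"
  shows "(\<forall>\<epsilon>::real. \<epsilon> > 0 \<longrightarrow> (\<exists>C::real. C > 0 \<and>
            (\<forall>E :: (real^2) set. finite E \<and> card E > k + 1 \<and> \<not> collinear E \<longrightarrow>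
              real (card E) ^ k \<le> C * real (card E) powr \<epsilon> * real (card (M2 k E)))))
       \<and> (\<exists>C::real. C > 0 \<and>
            (\<forall>N::nat. \<exists>E :: (real^2) set. finite E \<and> card E \<ge> N \<and> \<not> collinear E \<and>
              real (card (M2 k E)) \<le> C * real (card E) ^ k))"
proof
  show "\<forall>\<epsilon>::real. \<epsilon> > 0 \<longrightarrow> (\<exists>C::real. C > 0 \<and>
            (\<forall>E :: (real^2) set. finite E \<and> card E > k + 1 \<and> \<not> collinear E \<longrightarrow>
              real (card E) ^ k \<le> C * real (card E) powr \<epsilon> * real (card (M2 k E))))"
    using card_M2_lower_bound[OF assms] by blast
  have sharp: "finite (line_and_point N) \<and> card (line_and_point N) \<ge> N \<and> \<not> collinear (line_and_point N) \<and>
      real (card (M2 k (line_and_point N))) \<le> 6 ^ k * real (card (line_and_point N)) ^ k" for N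
    using card_line_and_point not_collinear_line_and_point card_M2_line_and_point by simp
  show "\<exists>C::real. C > 0 \<and>
            (\<forall>N::nat. \<exists>E :: (real^2) set. finite E \<and> card E \<ge> N \<and> \<not> collinear E \<and>
              real (card (M2 k E)) \<le> C * real (card E) ^ k)"
    by (rule exI[of _ "6 ^ k"], intro conjI allI, simp, rule exI, rule sharp)
qed

end
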